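(* Let $f:\mathbb{R}\to\mathbb{R}$ be smooth with $f^{(3)}>0$ and $f^{(4)}>0$ on $\mathbb{R}$, and let $\mathcal{M}_{6,f}=(\mathbb{R}^6,g_{6,f})$ be the pseudo-Riemannian manifold defined in the context. Then $\mathcal{M}_{6,f}$ is a $6$-dimensional neutral signature manifold which is $2$-curvature homogeneous, which is complete, which is ($0$-)modeled on an irreducible neutral signature symmetric space, and all of whose local scalar Weyl invariants vanish identically. Moreover, for generic $f$, $\mathcal{M}_{6,f}$ is not affine $3$-curvature homogeneous; here $f$ is generic if the zero set of the derivative $\alpha_{6,f}'$ of $\alpha_{6,f}:=\dfrac{f^{(3)}f^{(5)}}{f^{(4)}f^{(4)}}$ is a discrete subset of $\mathbb{R}$.
   Context: Manifold. Let $(x,y,z_0,\bar x,\bar y,\bar z_0)$ be coordinates on $\mathbb{R}^6$. For smooth $f=f(y)$ the metric $g_{6,f}$, of neutral signature $(3,3)$, is the symmetric tensor whose only non-zero components (up to symmetry) are $g(\partial_{z_0},\partial_{\bar z_0})=1$, $g(\partial_x,\partial_{\bar x})=1$, $g(\partial_y,\partial_{\bar y})=1$, $g(\partial_x,\partial_x)=-2\big(f(y)+yz_0\big)$. Complete means that all geodesics are defined on all of $\mathbb{R}$. Curvature. $\nabla$ is the Levi-Civita connection, $\mathcal{R}(\xi_1,\xi_2)=\nabla_{\xi_1}\nabla_{\xi_2}-\nabla_{\xi_2}\nabla_{\xi_1}-\nabla_{[\xi_1,\xi_2]}$ the curvature operator, $R(\xi_1,\xi_2,\xi_3,\xi_4)=g(\mathcal{R}(\xi_1,\xi_2)\xi_3,\xi_4)$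 the curvature tensor, $\nabla^kR$ its $k$-th covariant derivative. A pseudo-Riemannian manifold $(M,g)$ is $k$-curvature homogeneous if for any $P,Q\in M$ there is a linear isomorphism $\phi:T_PM\to T_QM$ with $\phi^*g_Q=g_P$ and $\phi^*\nabla^iR_Q=\nabla^iR_P$ for $0\le i\le k$. It is affine $k$-curvature homogeneous if for any $P,Q\in M$ there is a linear isomorphism $\phi:T_PM\to T_QM$ (not required to be an isometry) with $\phi^*\nabla^i\mathcal{R}_Q=\nabla^i\mathcal{R}_P$ for $0\le i\le k$. $(M,g_M)$ is ($0$-)modeled on a symmetric space $(N,g_N)$ if for every $P\in M$ and $Q\in N$ there is a linear isomorphism $\phi:T_PM\to T_QN$ with $\phi^*(g_N)_Q=(g_M)_P$ and $\phi^*(R_N)_Q=(R_M)_P$. Irreducibility. A symmetric space $N$ is irreducible if for $Q\in N$ the triple $(T_QN,g_Q,R_Q)$ is irreducible, meaning there is no decomposition $T_QN=V_1\oplus V_2$ with $V_1,V_2\neq\{0\}$ which induces decompositions $g_Q=g_1\oplus g_2$ and $R_Q=R_1\oplus R_2$, where $g_i$ and $R_i$ are tensors on $V_i$ (so that all components of $g_Q$ and $R_Q$ with arguments from both $V_1$ and $V_2$ vanish). Scalar Weyl invariants: the scalar functions obtained by using the metric to contract all indices in pairs in a polynomial expression (without constant term) in $R$ and its covariant derivatives $\nabla^kR$; i.e. linear combinations of complete metric contractions of tensor products of one or more of the tensors $\nabla^kR$, $k\ge0$. *)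

theory Defs
  imports "HOL-Analysis.Analysis"
begin

text \<open>All manifolds here have underlying manifold \<^typ>\<open>real^'n\<close>. Each tangent space is identified with
  \<^typ>\<open>real^'n\<close> by the global coordinates, and a vector field is a map \<^typ>\<open>real^'n \<Rightarrow> real^'n\<close>.
  A tensor field is evaluated on the list of its arguments, and matters only on lists of the
  right length.\<close>

type_synonym 'n vec_field = "real^'n \<Rightarrow> real^'n"
type_synonym 'n metric = "real^'n \<Rightarrow> real^'n \<Rightarrow> real^'n \<Rightarrow> real"
type_synonym 'n form_field = "real^'n \<Rightarrow> (real^'n) list \<Rightarrow> real"
type_synonym 'n op_field = "real^'n \<Rightarrow> (real^'n) list \<Rightarrow> real^'n"

text \<open>\<open>C\<^sup>\<infinity>\<close>: every iterated directional derivative is Frechet differentiable everywhere.\<close>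

definition smooth :: "('a::euclidean_space \<Rightarrow> 'b::real_normed_vector) \<Rightarrow> bool" where
  "smooth h \<longleftrightarrow>
     (\<forall>vs x. foldr (\<lambda>v h x. frechet_derivative h (at x) v) vs h differentiable (at x))"


subsection \<open>Pseudo-Riemannian metrics\<close>

definition pseudo_riemannian :: "'n::finite metric \<Rightarrow> bool" where
  "pseudo_riemannian g \<longleftrightarrow>
     (\<forall>p. bilinear (g p)) \<and>
     (\<forall>p u v. g p u v = g p v u) \<and>
     (\<forall>p u. (\<forall>v. g p u v = 0) \<longrightarrow> u = 0) \<and>
     (\<forall>u v. smooth (\<lambda>p. g p u v))"

text \<open>Signature \<open>(r,s)\<close>: there is an orthonormal basis with \<open>r\<close> timelike and \<open>s\<close> spacelike vectors
  (independence of the \<open>e i\<close> follows from the orthogonality relations).\<close>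

definition has_signature :: "(real^'n \<Rightarrow> real^'n \<Rightarrow> real) \<Rightarrow> nat \<Rightarrow> nat \<Rightarrow> bool" where
  "has_signature B r s \<longleftrightarrow>
     (\<exists>e :: 'n::finite \<Rightarrow> real^'n.
        (\<forall>i j. i \<noteq> j \<longrightarrow> B (e i) (e j) = 0) \<and>
        (\<forall>i. B (e i) (e i) = -1 \<or> B (e i) (e i) = 1) \<and>
        card {i. B (e i) (e i) = -1} = r \<and>
        card {i. B (e i) (e i) = 1} = s)"

definition inv_metric :: "'n::finite metric \<Rightarrow> real^'n \<Rightarrow> real^'n^'n" where
  "inv_metric g p = matrix_inv (\<chi> i j. g p (axis i 1) (axis j 1))"


subsection \<open>Levi-Civita connection and curvature\<close>

text \<open>The bilinear extension of
  \<open>\<Gamma>\<^sub>i\<^sub>j\<^sup>k = (1/2) \<Sum>\<^sub>l g\<^sup>k\<^sup>l (\<partial>\<^sub>i g\<^sub>j\<^sub>l + \<partial>\<^sub>j g\<^sub>i\<^sub>l - \<partial>\<^sub>l g\<^sub>i\<^sub>j)\<close>.\<close>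

definition christoffel :: "'n::finite metric \<Rightarrow> real^'n \<Rightarrow> real^'n \<Rightarrow> real^'n \<Rightarrow> real^'n" where
  "christoffel g p u v = (\<chi> k. \<Sum>l\<in>UNIV. inv_metric g p $ k $ l *
     ((frechet_derivative (\<lambda>q. g q v (axis l 1)) (at p) u
       + frechet_derivative (\<lambda>q. g q u (axis l 1)) (at p) v
       - frechet_derivative (\<lambda>q. g q u v) (at p) (axis l 1)) / 2))"

definition nabla :: "'n::finite metric \<Rightarrow> 'n vec_field \<Rightarrow> 'n vec_field \<Rightarrow> 'n vec_field" where
  "nabla g X Y = (\<lambda>p. frechet_derivative Y (at p) (X p) + christoffel g p (X p) (Y p))"

definition lie_bracket :: "'n::finite vec_field \<Rightarrow> 'n vec_field \<Rightarrow> 'n vec_field" where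
  "lie_bracket X Y =
     (\<lambda>p. frechet_derivative Y (at p) (X p) - frechet_derivative X (at p) (Y p))"

definition curvature_operator ::
  "'n::finite metric \<Rightarrow> 'n vec_field \<Rightarrow> 'n vec_field \<Rightarrow> 'n vec_field \<Rightarrow> 'n vec_field" where
  "curvature_operator g X Y Z =
     (\<lambda>p. nabla g X (nabla g Y Z) p - nabla g Y (nabla g X Z) p - nabla g (lie_bracket X Y) Z p)"

text \<open>Tensors are evaluated on tangent vectors by extending these to constant vector fields, which is
  legitimate by tensoriality; the values on axis vectors are the usual coordinate components.\<close>

definition curv_op_tensor :: "'n::finite metric \<Rightarrow> 'n op_field" where
  "curv_op_tensor g p vs =
     curvature_operator g (\<lambda>_. vs ! 0) (\<lambda>_. vs ! 1) (\<lambda>_. vs ! 2) p"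

definition curv_tensor :: "'n::finite metric \<Rightarrow> 'n form_field" where
  "curv_tensor g p vs = g p (curv_op_tensor g p (take 3 vs)) (vs ! 3)"

text \<open>In a covariant derivative the new (differentiation) argument is put first:
  \<open>(\<nabla>T)(v, v\<^sub>1, \<dots>, v\<^sub>r) = (\<nabla>\<^sub>v T)(v\<^sub>1, \<dots>, v\<^sub>r)\<close>.\<close>

fun cov_deriv_form :: "'n::finite metric \<Rightarrow> 'n form_field \<Rightarrow> 'n form_field" where
  "cov_deriv_form g T p [] = 0"
| "cov_deriv_form g T p (v # vs) =
     frechet_derivative (\<lambda>q. T q vs) (at p) v
     - (\<Sum>s<length vs. T p (vs[s := nabla g (\<lambda>_. v) (\<lambda>_. vs ! s) p]))"

fun cov_deriv_op :: "'n::finite metric \<Rightarrow> 'n op_field \<Rightarrow> 'n op_field" where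
  "cov_deriv_op g T p [] = 0"
| "cov_deriv_op g T p (v # vs) =
     nabla g (\<lambda>_. v) (\<lambda>q. T q vs) p
     - (\<Sum>s<length vs. T p (vs[s := nabla g (\<lambda>_. v) (\<lambda>_. vs ! s) p]))"

definition nabla_R :: "'n::finite metric \<Rightarrow> nat \<Rightarrow> 'n form_field" where
  "nabla_R g k = (cov_deriv_form g ^^ k) (curv_tensor g)"

definition nabla_R_op :: "'n::finite metric \<Rightarrow> nat \<Rightarrow> 'n op_field" where
  "nabla_R_op g k = (cov_deriv_op g ^^ k) (curv_op_tensor g)"


subsection \<open>Homogeneity and models\<close>

definition curvature_homogeneous :: "nat \<Rightarrow> 'n::finite metric \<Rightarrow> bool" where
  "curvature_homogeneous k g \<longleftrightarrow>
     (\<forall>P Q. \<exists>\<phi>. linear \<phi> \<and> bij \<phi> \<and>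
        (\<forall>u v. g Q (\<phi> u) (\<phi> v) = g P u v) \<and>
        (\<forall>i\<le>k. \<forall>vs. length vs = 4 + i \<longrightarrow> nabla_R g i Q (map \<phi> vs) = nabla_R g i P vs))"

definition affine_curvature_homogeneous :: "nat \<Rightarrow> 'n::finite metric \<Rightarrow> bool" where
  "affine_curvature_homogeneous k g \<longleftrightarrow>
     (\<forall>P Q. \<exists>\<phi>. linear \<phi> \<and> bij \<phi> \<and>
        (\<forall>i\<le>k. \<forall>vs. length vs = 3 + i \<longrightarrow>
           nabla_R_op g i Q (map \<phi> vs) = \<phi> (nabla_R_op g i P vs)))"

definition modeled_on :: "'n::finite metric \<Rightarrow> 'm::finite metric \<Rightarrow> bool" where
  "modeled_on gM gN \<longleftrightarrow>
     (\<forall>P Q. \<exists>\<phi>. linear \<phi> \<and> bij \<phi> \<and>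
        (\<forall>u v. gN Q (\<phi> u) (\<phi> v) = gM P u v) \<and>
        (\<forall>vs. length vs = 4 \<longrightarrow> curv_tensor gN Q (map \<phi> vs) = curv_tensor gM P vs))"


subsection \<open>Symmetric spaces, irreducibility\<close>

definition isometry :: "'n::finite metric \<Rightarrow> 'n vec_field \<Rightarrow> bool" where
  "isometry g \<sigma> \<longleftrightarrow> bij \<sigma> \<and> smooth \<sigma> \<and> smooth (inv \<sigma>) \<and>
     (\<forall>p u v. g (\<sigma> p) (frechet_derivative \<sigma> (at p) u) (frechet_derivative \<sigma> (at p) v) = g p u v)"

text \<open>Every point is fixed by a global isometry with differential \<open>-1\<close> there.\<close>

definition symmetric_space :: "'n::finite metric \<Rightarrow> bool" where
  "symmetric_space g \<longleftrightarrow> pseudo_riemannian g \<and>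
     (\<forall>P. \<exists>\<sigma>. isometry g \<sigma> \<and> \<sigma> P = P \<and> (\<forall>v. frechet_derivative \<sigma> (at P) v = - v))"

definition irreducible_model ::
  "(real^'n \<Rightarrow> real^'n \<Rightarrow> real) \<Rightarrow> ((real^'n::finite) list \<Rightarrow> real) \<Rightarrow> bool" where
  "irreducible_model B A \<longleftrightarrow>
     \<not> (\<exists>V1 V2. subspace V1 \<and> subspace V2 \<and> V1 \<noteq> {0} \<and> V2 \<noteq> {0} \<and>
          V1 \<inter> V2 = {0} \<and> {a + b | a b. a \<in> V1 \<and> b \<in> V2} = UNIV \<and>
          (\<forall>a\<in>V1. \<forall>b\<in>V2. B a b = 0 \<and> B b a = 0) \<and>
          (\<forall>vs. length vs = 4 \<and> set vs \<subseteq> V1 \<union> V2 \<and> \<not> set vs \<subseteq> V1 \<and> \<not> set vs \<subseteq> V2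
              \<longrightarrow> A vs = 0))"

definition irreducible_space :: "'n::finite metric \<Rightarrow> bool" where
  "irreducible_space g \<longleftrightarrow> (\<forall>Q. irreducible_model (g Q) (curv_tensor g Q))"


subsection \<open>Completeness\<close>

definition geodesic_on :: "'n::finite metric \<Rightarrow> real set \<Rightarrow> (real \<Rightarrow> real^'n) \<Rightarrow> bool" where
  "geodesic_on g I \<gamma> \<longleftrightarrow>
     (\<exists>\<gamma>'. \<forall>t\<in>I. (\<gamma> has_vector_derivative \<gamma>' t) (at t) \<and>
        (\<gamma>' has_vector_derivative - christoffel g (\<gamma> t) (\<gamma>' t) (\<gamma>' t)) (at t))"

definition geodesically_complete :: "'n::finite metric \<Rightarrow> bool" where
  "geodesically_complete g \<longleftrightarrow>
     (\<forall>I \<gamma>. open I \<and> is_interval I \<and> geodesic_on g I \<gamma> \<longrightarrow>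
        (\<exists>\<delta>. geodesic_on g UNIV \<delta> \<and> (\<forall>t\<in>I. \<delta> t = \<gamma> t)))"


subsection \<open>Scalar Weyl invariants\<close>

text \<open>\<open>\<nabla>\<^sup>k\<^sup>1R \<otimes> \<dots> \<otimes> \<nabla>\<^sup>k\<^sup>mR\<close> for \<open>ks = [k1, \<dots>, km]\<close>.\<close>

fun nabla_R_product :: "'n::finite metric \<Rightarrow> nat list \<Rightarrow> 'n form_field" where
  "nabla_R_product g [] p vs = 1"
| "nabla_R_product g (k # ks) p vs =
     nabla_R g k p (take (4 + k) vs) * nabla_R_product g ks p (drop (4 + k) vs)"

definition product_rank :: "nat list \<Rightarrow> nat" where
  "product_rank ks = (\<Sum>k\<leftarrow>ks. 4 + k)"

text \<open>The complete contraction of a tensor of even rank \<open>N\<close> in which, for each \<open>j < N/2\<close>, slot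
  \<open>\<pi> (2j)\<close> is paired with slot \<open>\<pi> (2j+1)\<close>; \<open>\<pi>\<close> is a permutation of the slots.\<close>

definition contraction ::
  "'n::finite metric \<Rightarrow> nat \<Rightarrow> (nat \<Rightarrow> nat) \<Rightarrow> 'n form_field \<Rightarrow> real^'n \<Rightarrow> real" where
  "contraction g N \<pi> T p =
     (\<Sum>is\<in>{is :: 'n list. length is = N}.
        (\<Prod>j<N div 2. inv_metric g p $ (is ! \<pi> (2 * j)) $ (is ! \<pi> (2 * j + 1)))
        * T p (map (\<lambda>i. axis i 1) is))"

inductive_set weyl_invariants :: "'n::finite metric \<Rightarrow> (real^'n \<Rightarrow> real) set" for g where
  contract: "ks \<noteq> [] \<Longrightarrow> even (product_rank ks) \<Longrightarrow>
     bij_betw \<pi> {..<product_rank ks} {..<product_rank ks} \<Longrightarrow>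
     contraction g (product_rank ks) \<pi> (nabla_R_product g ks) \<in> weyl_invariants g"
| add: "h \<in> weyl_invariants g \<Longrightarrow> h' \<in> weyl_invariants g \<Longrightarrow>
     (\<lambda>p. h p + h' p) \<in> weyl_invariants g"
| scale: "h \<in> weyl_invariants g \<Longrightarrow> (\<lambda>p. c * h p) \<in> weyl_invariants g"


subsection \<open>The manifolds \<open>\<M>\<^sub>6\<^sub>,\<^sub>f\<close>\<close>

text \<open>The coordinates \<open>1, \<dots>, 6\<close> are \<open>x, y, z\<^sub>0\<close> and their barred partners, in this order
  (in the index type \<^typ>\<open>6\<close> the numeral \<open>6\<close> denotes the same element as \<open>0\<close>).\<close>

definition g6 :: "(real \<Rightarrow> real) \<Rightarrow> 6 metric" where
  "g6 f p u v =
     (u$1 * v$4 + u$4 * v$1) + (u$2 * v$5 + u$5 * v$2) + (u$3 * v$6 + u$6 * v$3)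
     - 2 * (f (p$2) + p$2 * p$3) * (u$1 * v$1)"

definition alpha6 :: "(real \<Rightarrow> real) \<Rightarrow> real \<Rightarrow> real" where
  "alpha6 f y = ((deriv ^^ 3) f y * (deriv ^^ 5) f y) / ((deriv ^^ 4) f y * (deriv ^^ 4) f y)"

definition generic :: "(real \<Rightarrow> real) \<Rightarrow> bool" where
  "generic f \<longleftrightarrow> discrete {y. deriv (alpha6 f) y = 0}"

end

theory Submission
  imports Defs
begin

text \<open>
  Put \<open>F = f(y) + y z\<^sub>0\<close>, and let \<open>K\<close> be the distribution spanned by the three barred coordinate
  fields \<open>e\<^sub>4, e\<^sub>5, e\<^sub>6\<close>. Since \<open>F\<close> depends only on \<open>y, z\<^sub>0\<close> and \<open>g\<close> is constant except for the term
  \<open>-2F dx\<^sup>2\<close>, the Christoffel map takes its values in \<open>K\<close> and vanishes if one argument lies in \<open>K\<close>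
  (\<open>christoffel_g6\<close>). Almost everything follows from this.

  The terms of the curvature that are quadratic in the connection vanish, and
  \<open>R\<close> is given by the Hessian of \<open>F\<close> in \<open>(y, z\<^sub>0)\<close>. \<open>R\<close> is annihilated by \<open>K\<close>, so a covariant
  derivative is an ordinary directional derivative. The only entry of the Hessian that is not
  constant is \<open>f''(y)\<close>; therefore \<open>\<nabla>\<^sup>kR\<close> with \<open>k > 0\<close> is \<open>f\<^sup>(\<^sup>k\<^sup>+\<^sup>2\<^sup>)(y)\<close> times a fixed tensor
  (\<open>nabla_R_g6\<close>, \<open>nabla_R_op_g6\<close>).

  Curvature homogeneity: rescaling \<open>e\<^sub>1, e\<^sub>2, e\<^sub>3\<close> by \<open>a, b, c\<close> and adding a multiple of \<open>e\<^sub>3\<close> to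
  \<open>e\<^sub>2\<close> and of \<open>e\<^sub>4\<close> to \<open>e\<^sub>1\<close> (\<open>model_frame\<close>) leaves exactly enough freedom to bring \<open>g\<close>, \<open>R\<close>,
  \<open>\<nabla>R\<close> and \<open>\<nabla>\<^sup>2R\<close> to a form that is the same at all points. The two shears alone
  (\<open>a = b = c = 1\<close>) bring \<open>g\<close> and \<open>R\<close> to the form that they take for the metric with \<open>f = 0\<close>. That
  metric is symmetric, because its central symmetries can be written down as polynomial maps
  (\<open>central_symmetry\<close>), and it is irreducible (\<open>irreducible_space_g6\<close>).

  Completeness: \<open>x, y, z\<^sub>0\<close> are affine along a geodesic, and the barred coordinates are then found
  by integrating continuous functions of the parameter twice. Weyl invariants: a contraction pairs
  two slots through the inverse metric, which vanishes on pairs of unbarred indices, while a barred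
  index annihilates every \<open>\<nabla>\<^sup>kR\<close>.

  Affine homogeneity of order three fails because \<open>\<nabla>\<R>\<close>, \<open>\<nabla>\<^sup>2\<R>\<close> and \<open>\<nabla>\<^sup>3\<R>\<close> have the same shape with
  coefficients \<open>f\<^sup>(\<^sup>3\<^sup>), f\<^sup>(\<^sup>4\<^sup>), f\<^sup>(\<^sup>5\<^sup>)\<close>. An isomorphism multiplies these by \<open>s m, s m\<^sup>2, s m\<^sup>3\<close> for some
  constants \<open>s, m\<close>, and this leaves the quotient \<open>f\<^sup>(\<^sup>3\<^sup>)f\<^sup>(\<^sup>5\<^sup>) / (f\<^sup>(\<^sup>4\<^sup>))\<^sup>2 = \<alpha>\<close> unchanged. So \<open>\<alpha>\<close> would be
  constant, and the zero set of \<open>\<alpha>'\<close> would be the whole line, which is not discrete.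
\<close>

section \<open>Coordinates on \<open>\<real>\<^sup>6\<close>\<close>

lemma exhaust_6: "x = 1 \<or> x = 2 \<or> x = 3 \<or> x = 4 \<or> x = 5 \<or> x = 6" for x :: 6
proof (induct x)
  case (of_int z)
  then have "0 \<le> z" and "z < 6" by simp_all
  then have "z = 0 \<or> z = 1 \<or> z = 2 \<or> z = 3 \<or> z = 4 \<or> z = 5" by arith
  then show ?case by auto
qed

lemma forall_6: "(\<forall>i::6. P i) \<longleftrightarrow> P 1 \<and> P 2 \<and> P 3 \<and> P 4 \<and> P 5 \<and> P 6"
  by (metis exhaust_6)

lemma UNIV_6: "(UNIV::6 set) = {1,2,3,4,5,6}"
  using exhaust_6 by blast

lemma sum_6: "sum f (UNIV::6 set) = f 1 + f 2 + f 3 + f 4 + f 5 + f 6"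
  unfolding UNIV_6 by (simp add: ac_simps)

lemma vec_eq_6: "v = w \<longleftrightarrow> v$1 = w$1 \<and> v$2 = w$2 \<and> v$3 = w$3 \<and> v$4 = w$4 \<and> v$5 = w$5 \<and> v$6 = w$6"
  for v w :: "'a^6"
  unfolding vec_eq_iff forall_6 by simp

definition vec6 :: "'a \<Rightarrow> 'a \<Rightarrow> 'a \<Rightarrow> 'a \<Rightarrow> 'a \<Rightarrow> 'a \<Rightarrow> 'a^6" where
  "vec6 a b c d e h = (\<chi> i. if i = 1 then a else if i = 2 then b else if i = 3 then c
     else if i = 4 then d else if i = 5 then e else h)"

lemma vec6_nth [simp]:
  "vec6 a b c d e h $ 1 = a" "vec6 a b c d e h $ 2 = b" "vec6 a b c d e h $ 3 = c"
  "vec6 a b c d e h $ 4 = d" "vec6 a b c d e h $ 5 = e" "vec6 a b c d e h $ 6 = h"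
  by (simp_all add: vec6_def)

lemma axis_6_nth [simp]:
  "axis (1::6) x $ 1 = x" "axis (1::6) x $ 2 = 0" "axis (1::6) x $ 3 = 0"
  "axis (1::6) x $ 4 = 0" "axis (1::6) x $ 5 = 0" "axis (1::6) x $ 6 = 0"
  "axis (2::6) x $ 1 = 0" "axis (2::6) x $ 2 = x" "axis (2::6) x $ 3 = 0"
  "axis (2::6) x $ 4 = 0" "axis (2::6) x $ 5 = 0" "axis (2::6) x $ 6 = 0"
  "axis (3::6) x $ 1 = 0" "axis (3::6) x $ 2 = 0" "axis (3::6) x $ 3 = x"
  "axis (3::6) x $ 4 = 0" "axis (3::6) x $ 5 = 0" "axis (3::6) x $ 6 = 0"
  "axis (4::6) x $ 1 = 0" "axis (4::6) x $ 2 = 0" "axis (4::6) x $ 3 = 0"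
  "axis (4::6) x $ 4 = x" "axis (4::6) x $ 5 = 0" "axis (4::6) x $ 6 = 0"
  "axis (5::6) x $ 1 = 0" "axis (5::6) x $ 2 = 0" "axis (5::6) x $ 3 = 0"
  "axis (5::6) x $ 4 = 0" "axis (5::6) x $ 5 = x" "axis (5::6) x $ 6 = 0"
  "axis (6::6) x $ 1 = 0" "axis (6::6) x $ 2 = 0" "axis (6::6) x $ 3 = 0"
  "axis (6::6) x $ 4 = 0" "axis (6::6) x $ 5 = 0" "axis (6::6) x $ 6 = x"
  by (simp_all add: axis_def)

section \<open>Smooth functions\<close>

lemma frechet_derivative_eqI:
  "(h has_derivative h') (at x) \<Longrightarrow> frechet_derivative h (at x) v = h' v"
  using frechet_derivative_at[of h h' x] by simp

text \<open>Smoothness is the largest property that implies differentiability and is inherited by all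
  directional derivatives; closure properties are proved by exhibiting a family of functions with
  these two features.\<close>

lemma smooth_coinduct:
  assumes "h \<in> S"
    and "\<And>h x. h \<in> S \<Longrightarrow> h differentiable (at x)"
    and "\<And>h v. h \<in> S \<Longrightarrow> (\<lambda>x. frechet_derivative h (at x) v) \<in> S"
  shows "smooth h"
proof -
  have "foldr (\<lambda>v h x. frechet_derivative h (at x) v) vs h \<in> S" for vs
    by (induction vs) (simp_all add: assms)
  then show ?thesis unfolding smooth_def using assms(2) by blast
qed

lemma smooth_differentiable: "smooth h \<Longrightarrow> h differentiable (at x)"
  unfolding smooth_def by (drule spec[of _ "[]"]) simp

lemma smooth_directional_derivative:
  assumes "smooth h" shows "smooth (\<lambda>x. frechet_derivative h (at x) v)"
  unfolding smooth_def
proof (intro allI)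
  fix vs x
  show "foldr (\<lambda>v h x. frechet_derivative h (at x) v) vs (\<lambda>x. frechet_derivative h (at x) v)
          differentiable (at x)"
    using assms[unfolded smooth_def, rule_format, of "vs @ [v]"] by simp
qed

lemma smooth_add:
  assumes "smooth h" "smooth k" shows "smooth (\<lambda>x. h x + k x)"
proof (rule smooth_coinduct[where S = "{\<lambda>x. h x + k x |h k. smooth h \<and> smooth k}"])
  show "(\<lambda>x. h x + k x) \<in> {\<lambda>x. h x + k x |h k. smooth h \<and> smooth k}"
    by (rule CollectI, rule exI[of _ h], rule exI[of _ k]) (simp add: assms)
next
  fix m :: "'a \<Rightarrow> 'b" and x
  assume "m \<in> {\<lambda>x. h x + k x |h k. smooth h \<and> smooth k}"
  then show "m differentiable (at x)"
    by (elim CollectE exE conjE) (simp add: differentiable_add smooth_differentiable)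
next
  fix m :: "'a \<Rightarrow> 'b" and v
  assume "m \<in> {\<lambda>x. h x + k x |h k. smooth h \<and> smooth k}"
  then obtain h k where m: "m = (\<lambda>x. h x + k x)" and hk: "smooth h" "smooth k" by blast
  have "(\<lambda>x. frechet_derivative m (at x) v) =
      (\<lambda>x. frechet_derivative h (at x) v + frechet_derivative k (at x) v)"
    unfolding m
    by (intro ext frechet_derivative_eqI has_derivative_add)
      (simp_all add: hk smooth_differentiable flip: frechet_derivative_works)
  then show "(\<lambda>x. frechet_derivative m (at x) v) \<in> {\<lambda>x. h x + k x |h k. smooth h \<and> smooth k}"
    by (intro CollectI exI[of _ "\<lambda>x. frechet_derivative h (at x) v"]
        exI[of _ "\<lambda>x. frechet_derivative k (at x) v"])
      (simp add: hk smooth_directional_derivative)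
qed

lemma smooth_scaled_linear_compose:
  fixes h :: "'b::euclidean_space \<Rightarrow> real" and L :: "'a::euclidean_space \<Rightarrow> 'b"
  assumes "smooth h" "bounded_linear L" shows "smooth (\<lambda>x. c * h (L x))"
proof -
  have der: "((\<lambda>x. c * h (L x)) has_derivative (\<lambda>v. c * frechet_derivative h (at (L x)) (L v))) (at x)"
    if "smooth h" for h :: "'b \<Rightarrow> real" and c x
  proof -
    have "(h has_derivative frechet_derivative h (at (L x))) (at (L x))"
      using that by (simp add: smooth_differentiable flip: frechet_derivative_works)
    from has_derivative_compose[OF bounded_linear_imp_has_derivative[OF assms(2)] this]
    show ?thesis by (rule has_derivative_mult_right)
  qed
  show ?thesis
  proof (rule smooth_coinduct[where S = "{\<lambda>x. c * h (L x) |c h. smooth h}"])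
    show "(\<lambda>x. c * h (L x)) \<in> {\<lambda>x. c * h (L x) |c h. smooth h}"
      by (rule CollectI, rule exI[of _ c], rule exI[of _ h]) (simp add: assms)
  next
    fix m :: "'a \<Rightarrow> real" and x assume "m \<in> {\<lambda>x. c * h (L x) |c h. smooth h}"
    then obtain c and h :: "'b \<Rightarrow> real" where "m = (\<lambda>x. c * h (L x))" "smooth h" by blast
    then show "m differentiable (at x)" using der[of h c x] unfolding differentiable_def by blast
  next
    fix m :: "'a \<Rightarrow> real" and v assume "m \<in> {\<lambda>x. c * h (L x) |c h. smooth h}"
    then obtain c and h :: "'b \<Rightarrow> real" where m: "m = (\<lambda>x. c * h (L x))" and h: "smooth h" by blast
    have "(\<lambda>x. frechet_derivative m (at x) v) = (\<lambda>x. c * frechet_derivative h (at (L x)) (L v))"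
      unfolding m using frechet_derivative_eqI[OF der[OF h]] by blast
    then show "(\<lambda>x. frechet_derivative m (at x) v) \<in> {\<lambda>x. c * h (L x) |c h. smooth h}"
      by (intro CollectI exI[of _ c] exI[of _ "\<lambda>y. frechet_derivative h (at y) (L v)"])
        (simp add: smooth_directional_derivative[OF h])
  qed
qed

lemma real_polynomial_function_directional_derivative:
  fixes h :: "'a::real_normed_vector \<Rightarrow> real"
  assumes "real_polynomial_function h"
  shows "\<exists>h'. (\<forall>x. (h has_derivative h' x) (at x)) \<and> (\<forall>v. real_polynomial_function (\<lambda>x. h' x v))"
  using assms
proof induction
  case (linear f)
  then show ?case
    by (intro exI[of _ "\<lambda>x. f"] conjI allI bounded_linear_imp_has_derivative
        real_polynomial_function.intros(2))
next
  case (const c)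
  show ?case
    by (intro exI[of _ "\<lambda>x v. 0"] conjI allI has_derivative_const
        real_polynomial_function.intros(2))
next
  case (add f g)
  then obtain f' g' where
    "\<And>x. (f has_derivative f' x) (at x)" "\<And>v. real_polynomial_function (\<lambda>x. f' x v)"
    "\<And>x. (g has_derivative g' x) (at x)" "\<And>v. real_polynomial_function (\<lambda>x. g' x v)" by blast
  then show ?case
    by (intro exI[of _ "\<lambda>x v. f' x v + g' x v"] conjI allI
        has_derivative_add real_polynomial_function.intros(3))
next
  case (mult f g)
  then obtain f' g' where
    "\<And>x. (f has_derivative f' x) (at x)" "\<And>v. real_polynomial_function (\<lambda>x. f' x v)"
    "\<And>x. (g has_derivative g' x) (at x)" "\<And>v. real_polynomial_function (\<lambda>x. g' x v)" by blast
  then show ?case using mult(1,2)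
    by (intro exI[of _ "\<lambda>x v. f x * g' x v + f' x v * g x"] conjI allI
        has_derivative_mult real_polynomial_function.intros(3) real_polynomial_function.intros(4))
qed

text \<open>The family of polynomial maps is closed under directional derivatives.\<close>

lemma polynomial_function_smooth:
  fixes h :: "'a::euclidean_space \<Rightarrow> 'b::euclidean_space"
  assumes "polynomial_function h" shows "smooth h"
proof (rule smooth_coinduct[where S = "{h. polynomial_function h}"])
  show "h \<in> {h. polynomial_function h}" using assms by simp
next
  fix h :: "'a \<Rightarrow> 'b" and x assume h: "h \<in> {h. polynomial_function h}"
  then show "h differentiable (at x)"
    by (simp add: differentiable_at_polynomial_function)
next
  fix h :: "'a \<Rightarrow> 'b" and v assume "h \<in> {h. polynomial_function h}"
  then have h: "polynomial_function h" by simp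
  have "real_polynomial_function (\<lambda>x. frechet_derivative h (at x) v \<bullet> b)" if "b \<in> Basis" for b
  proof -
    have "real_polynomial_function (\<lambda>x. h x \<bullet> b)"
      using h that by (simp add: polynomial_function_iff_Basis_inner)
    then obtain h' where h': "\<And>x. ((\<lambda>x. h x \<bullet> b) has_derivative h' x) (at x)"
      and p: "\<And>v. real_polynomial_function (\<lambda>x. h' x v)"
      using real_polynomial_function_directional_derivative by blast
    have "(h has_derivative frechet_derivative h (at x)) (at x)" for x
      using differentiable_at_polynomial_function[OF h] by (simp flip: frechet_derivative_works)
    then have "((\<lambda>x. h x \<bullet> b) has_derivative (\<lambda>v. frechet_derivative h (at x) v \<bullet> b)) (at x)" for x
      by (rule has_derivative_inner_left)
    then have "(\<lambda>v. frechet_derivative h (at x) v \<bullet> b) = h' x" for x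
      using has_derivative_unique[OF _ h'] by simp
    then have "(\<lambda>x. frechet_derivative h (at x) v \<bullet> b) = (\<lambda>x. h' x v)"
      by (simp add: fun_eq_iff)
    then show ?thesis using p by simp
  qed
  then show "(\<lambda>x. frechet_derivative h (at x) v) \<in> {h. polynomial_function h}"
    by (simp add: polynomial_function_iff_Basis_inner)
qed

lemma smooth_iterated_deriv:
  fixes f :: "real \<Rightarrow> real"
  assumes "smooth f" shows "smooth ((deriv ^^ n) f)"
proof (induction n)
  case (Suc n)
  have "deriv h x = frechet_derivative h (at x) 1" if "smooth h" for h :: "real \<Rightarrow> real" and x
    using frechet_derivative_eqI[of h "(*) (deriv h x)" x 1] smooth_differentiable[OF that, of x]
    by (simp add: DERIV_deriv_iff_real_differentiable flip: has_field_derivative_def)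
  then have "deriv ((deriv ^^ n) f) = (\<lambda>x. frechet_derivative ((deriv ^^ n) f) (at x) 1)"
    using Suc by blast
  then show ?case using smooth_directional_derivative[OF Suc] by simp
qed (use assms in simp)

lemma iterated_deriv_has_real_derivative:
  fixes f :: "real \<Rightarrow> real"
  assumes "smooth f" shows "((deriv ^^ n) f has_real_derivative (deriv ^^ Suc n) f x) (at x)"
  using smooth_differentiable[OF smooth_iterated_deriv[OF assms]]
  by (simp add: DERIV_deriv_iff_real_differentiable)

lemma iterated_deriv_coordinate_has_derivative:
  fixes f :: "real \<Rightarrow> real" and p :: "real^'n"
  assumes "smooth f"
  shows "((\<lambda>q. (deriv ^^ n) f (q$i)) has_derivative (\<lambda>v. (deriv ^^ Suc n) f (p$i) * v$i)) (at p)"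
  by (rule has_derivative_compose[OF bounded_linear_imp_has_derivative[OF bounded_linear_vec_nth]
    iterated_deriv_has_real_derivative[OF assms, unfolded has_field_derivative_def]])

lemma real_polynomial_function_vec_nth: "real_polynomial_function (\<lambda>p::real^'n. p$i)"
  by (rule real_polynomial_function.intros(1)[OF bounded_linear_vec_nth])

section \<open>The metric and its Levi-Civita connection\<close>

lemma pseudo_riemannian_g6:
  assumes "smooth f" shows "pseudo_riemannian (g6 f)"
  unfolding pseudo_riemannian_def
proof (intro conjI allI impI)
  fix p show "bilinear (g6 f p)"
    unfolding bilinear_def by (auto intro!: linearI simp: g6_def algebra_simps)
next
  fix p u v show "g6 f p u v = g6 f p v u" by (simp add: g6_def algebra_simps)
next
  fix p u assume *: "\<forall>v. g6 f p u v = 0"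
  show "u = 0"
    using *[rule_format, of "axis 1 1"] *[rule_format, of "axis 2 1"] *[rule_format, of "axis 3 1"]
      *[rule_format, of "axis 4 1"] *[rule_format, of "axis 5 1"] *[rule_format, of "axis 6 1"]
    unfolding vec_eq_6 by (simp add: g6_def)
next
  fix u v :: "real^6"
  let ?q = "\<lambda>p::real^6. (u$1 * v$4 + u$4 * v$1) + (u$2 * v$5 + u$5 * v$2) + (u$3 * v$6 + u$6 * v$3)
    + (- 2 * (u$1 * v$1)) * (p$2 * p$3)"
  have "real_polynomial_function ?q"
    by (rule real_polynomial_function.intros(3,4) | rule real_polynomial_function_vec_nth
        | rule real_polynomial_function.intros(2))+
  then have "smooth ?q"
    by (simp add: polynomial_function_smooth real_polynomial_function_eq)
  moreover have "smooth (\<lambda>p::real^6. (- 2 * (u$1 * v$1)) * f (p$2))"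
    by (rule smooth_scaled_linear_compose[OF assms bounded_linear_vec_nth])
  ultimately have "smooth (\<lambda>p. ?q p + (- 2 * (u$1 * v$1)) * f (p$2))" by (rule smooth_add)
  then show "smooth (\<lambda>p. g6 f p u v)" by (simp add: g6_def algebra_simps)
qed

text \<open>The vectors \<open>e\<^sub>1 + F e\<^sub>4\<close> and \<open>e\<^sub>4\<close>, \<open>e\<^sub>2\<close> and \<open>e\<^sub>5\<close>, \<open>e\<^sub>3\<close> and \<open>e\<^sub>6\<close> form three mutually orthogonal
  hyperbolic pairs \<open>E, E'\<close>, and each pair contributes \<open>E \<plusminus> E'/2\<close> to an orthonormal basis.\<close>

lemma has_signature_g6: "has_signature (g6 f P) 3 3"
proof -
  let ?F = "f (P$2) + P$2 * P$3"
  define e :: "6 \<Rightarrow> real^6" where "e = vec_nth (vec6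
     (vec6 1 0 0 (?F + 1/2) 0 0) (vec6 0 1 0 0 (1/2) 0) (vec6 0 0 1 0 0 (1/2))
     (vec6 1 0 0 (?F - 1/2) 0 0) (vec6 0 1 0 0 (-1/2) 0) (vec6 0 0 1 0 0 (-1/2)))"
  have orth: "\<forall>i j. i \<noteq> j \<longrightarrow> g6 f P (e i) (e j) = 0"
    unfolding forall_6 by (simp add: e_def g6_def)
  have norm: "g6 f P (e i) (e i) = (if i \<in> {1,2,3} then 1 else -1)" for i
    using exhaust_6[of i] by (auto simp: e_def g6_def)
  have "{i::6. i \<in> {1,2,3}} = {1,2,3}" "{i::6. i \<notin> {1,2,3}} = {4,5,6}"
    using exhaust_6 by auto
  then have "card {i. g6 f P (e i) (e i) = -1} = 3" "card {i. g6 f P (e i) (e i) = 1} = 3"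
    unfolding norm by (simp_all add: if_distrib)
  then show ?thesis unfolding has_signature_def using orth norm by (intro exI[of _ e]) auto
qed

lemma inv_metric_g6:
  "inv_metric (g6 f) p = vec6 (vec6 0 0 0 1 0 0) (vec6 0 0 0 0 1 0) (vec6 0 0 0 0 0 1)
     (vec6 1 0 0 (2 * (f (p$2) + p$2 * p$3)) 0 0) (vec6 0 1 0 0 0 0) (vec6 0 0 1 0 0 0)"
  (is "_ = ?I")
proof -
  let ?G = "\<chi> i j. g6 f p (axis i 1) (axis j 1)"
  have 1: "?G ** ?I = mat 1"
    unfolding vec_eq_6 by (simp add: matrix_matrix_mult_def mat_def sum_6 g6_def)
  then have "?I ** ?G = mat 1" by (simp add: matrix_left_right_inverse)
  with 1 have "\<exists>A'. ?G ** A' = mat 1 \<and> A' ** ?G = mat 1" by blast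
  from someI_ex[OF this] have "matrix_inv ?G ** ?G = mat 1"
    unfolding matrix_inv_def by blast
  then have "matrix_inv ?G ** (?G ** ?I) = ?I"
    unfolding matrix_mul_assoc by simp
  moreover have "matrix_inv ?G ** (?G ** ?I) = matrix_inv ?G" unfolding 1 by simp
  ultimately
  show ?thesis unfolding inv_metric_def by simp
qed

lemma g6_has_derivative:
  assumes "smooth f"
  shows "((\<lambda>q. g6 f q v w) has_derivative
     (\<lambda>u. - 2 * ((deriv f (p$2) + p$3) * u$2 + p$2 * u$3) * (v$1 * w$1))) (at p)"
  unfolding g6_def
  by (rule derivative_eq_intros iterated_deriv_coordinate_has_derivative[OF assms, where n=0, simplified]
      bounded_linear_imp_has_derivative bounded_linear_vec_nth refl)+
    (auto simp: algebra_simps fun_eq_iff)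

text \<open>The Christoffel map in terms of the partial derivatives \<open>F\<^sub>y = f' + z\<^sub>0\<close> and \<open>F\<^sub>z = y\<close>.\<close>

lemma christoffel_g6:
  assumes "smooth f"
  shows "christoffel (g6 f) p u v = vec6 0 0 0
     (- ((deriv f (p$2) + p$3) * (u$1 * v$2 + u$2 * v$1) + p$2 * (u$1 * v$3 + u$3 * v$1)))
     ((deriv f (p$2) + p$3) * (u$1 * v$1)) (p$2 * (u$1 * v$1))"
  unfolding christoffel_def vec_eq_6
  by (simp add: sum_6 inv_metric_g6 frechet_derivative_eqI[OF g6_has_derivative[OF assms]] field_simps)

text \<open>Tangency to the distribution \<open>K\<close> spanned by the barred coordinate fields. By \<open>g6_def\<close> it is
  totally isotropic, and by \<open>christoffel_g6\<close> it is parallel.\<close>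

definition null_parallel :: "real^6 \<Rightarrow> bool" where
  "null_parallel v \<longleftrightarrow> v$1 = 0 \<and> v$2 = 0 \<and> v$3 = 0"

section \<open>Curvature and its covariant derivatives\<close>

text \<open>The components \<open>(1,2)\<close> and \<open>(1,3)\<close> of the bivector \<open>v\<^sub>k \<and> v\<^sub>k\<^sub>+\<^sub>1\<close>.\<close>

definition wedge2 :: "(real^6) list \<Rightarrow> nat \<Rightarrow> real" where
  "wedge2 vs k = (vs!k)$1 * (vs!Suc k)$2 - (vs!k)$2 * (vs!Suc k)$1"

definition wedge3 :: "(real^6) list \<Rightarrow> nat \<Rightarrow> real" where
  "wedge3 vs k = (vs!k)$1 * (vs!Suc k)$3 - (vs!k)$3 * (vs!Suc k)$1"

lemma nabla_const: "nabla g (\<lambda>_. u) (\<lambda>_. v) p = christoffel g p u v"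
  by (simp add: nabla_def)

lemma christoffel_zero_left: "smooth f \<Longrightarrow> christoffel (g6 f) p 0 v = 0"
  by (simp add: christoffel_g6 vec_eq_6)

lemma vec6_has_derivative:
  assumes "(a has_derivative a') F" "(b has_derivative b') F" "(c has_derivative c') F"
    "(d has_derivative d') F" "(e has_derivative e') F" "(h has_derivative h') F"
  shows "((\<lambda>x. vec6 (a x) (b x) (c x) (d x) (e x) (h x) :: real^6) has_derivative
     (\<lambda>v. vec6 (a' v) (b' v) (c' v) (d' v) (e' v) (h' v))) F"
proof -
  have vec6_sum: "vec6 a b c d e h = a *\<^sub>R axis 1 1 + b *\<^sub>R axis 2 1 + c *\<^sub>R axis 3 1
      + d *\<^sub>R axis 4 1 + e *\<^sub>R axis 5 1 + h *\<^sub>R (axis 6 1 :: real^6)" for a b c d e h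
    unfolding vec_eq_6 by simp
  show ?thesis unfolding vec6_sum
    by (intro has_derivative_add has_derivative_scaleR_left assms)
qed

lemma christoffel_g6_has_derivative:
  assumes "smooth f"
  shows "((\<lambda>p. christoffel (g6 f) p u v) has_derivative (\<lambda>w. vec6 0 0 0
     (- (((deriv ^^ 2) f (p$2) * w$2 + w$3) * (u$1 * v$2 + u$2 * v$1)
        + w$2 * (u$1 * v$3 + u$3 * v$1)))
     (((deriv ^^ 2) f (p$2) * w$2 + w$3) * (u$1 * v$1)) (w$2 * (u$1 * v$1)))) (at p)"
  unfolding christoffel_g6[OF assms]
  by (rule vec6_has_derivative;
     (rule derivative_eq_intros iterated_deriv_coordinate_has_derivative[OF assms, where n="Suc 0", simplified]
      bounded_linear_imp_has_derivative bounded_linear_vec_nth refl)+)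
    (auto simp: algebra_simps fun_eq_iff numeral_2_eq_2)

text \<open>The terms \<open>\<Gamma>(u, \<Gamma>(v, w))\<close> vanish, and what remains is the derivative of the Christoffel map, that
  is, the Hessian of \<open>F\<close> with the entries \<open>F\<^sub>y\<^sub>y = f''\<close>, \<open>F\<^sub>y\<^sub>z = 1\<close>, \<open>F\<^sub>z\<^sub>z = 0\<close>.\<close>

lemma curv_op_tensor_g6:
  assumes "smooth f"
  shows "curv_op_tensor (g6 f) p vs =
     ((deriv ^^ 2) f (p$2) * wedge2 vs 0 + wedge3 vs 0) *\<^sub>R vec6 0 0 0 ((vs!2)$2) (- (vs!2)$1) 0
     + wedge2 vs 0 *\<^sub>R vec6 0 0 0 ((vs!2)$3) 0 (- (vs!2)$1)"
proof -
  have *: "nabla (g6 f) (\<lambda>_. u) (nabla (g6 f) (\<lambda>_. v) (\<lambda>_. w)) p = vec6 0 0 0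
     (- (((deriv ^^ 2) f (p$2) * u$2 + u$3) * (v$1 * w$2 + v$2 * w$1)
        + u$2 * (v$1 * w$3 + v$3 * w$1)))
     (((deriv ^^ 2) f (p$2) * u$2 + u$3) * (v$1 * w$1)) (u$2 * (v$1 * w$1))" for u v w
    unfolding nabla_const
    unfolding nabla_def frechet_derivative_eqI[OF christoffel_g6_has_derivative[OF assms]]
    by (simp add: christoffel_g6[OF assms] vec_eq_6)
  have lie: "lie_bracket (\<lambda>_. u) (\<lambda>_. v) = (\<lambda>_. 0)" for u v :: "real^6"
    by (simp add: lie_bracket_def fun_eq_iff)
  show ?thesis
    unfolding curv_op_tensor_def curvature_operator_def lie *
    unfolding nabla_const christoffel_zero_left[OF assms]
    by (simp add: vec_eq_6 wedge2_def wedge3_def algebra_simps)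
qed

text \<open>The curvature tensor and operator that belong to the Hessian with entries \<open>c, h, 0\<close>, preceded by
  \<open>k\<close> factors \<open>dy\<close>. Every \<open>\<nabla>\<^sup>kR\<close> is of this form: \<open>h = 1\<close> occurs for \<open>k = 0\<close> only, as the mixed entry of
  the Hessian is constant.\<close>

definition curv_form :: "nat \<Rightarrow> real \<Rightarrow> real \<Rightarrow> (real^6) list \<Rightarrow> real" where
  "curv_form k c h vs = (\<Prod>i<k. (vs!i)$2) *
     - (c * (wedge2 vs k * wedge2 vs (k+2))
        + h * (wedge3 vs k * wedge2 vs (k+2) + wedge2 vs k * wedge3 vs (k+2)))"

definition curv_op :: "nat \<Rightarrow> real \<Rightarrow> real \<Rightarrow> (real^6) list \<Rightarrow> real^6" where
  "curv_op k c h vs = (\<Prod>i<k. (vs!i)$2) *\<^sub>R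
     ((c * wedge2 vs k + h * wedge3 vs k) *\<^sub>R vec6 0 0 0 ((vs!(k+2))$2) (- (vs!(k+2))$1) 0
      + (h * wedge2 vs k) *\<^sub>R vec6 0 0 0 ((vs!(k+2))$3) 0 (- (vs!(k+2))$1))"

lemma curv_form_null_parallel:
  assumes "s < 4 + k" "null_parallel (vs!s)" shows "curv_form k c h vs = 0"
proof (cases "s < k")
  case True
  then have "(\<Prod>i<k. (vs!i)$2) = 0" using assms(2) by (auto simp: null_parallel_def)
  then show ?thesis by (simp add: curv_form_def)
next
  case False
  then have "s = k \<or> s = Suc k \<or> s = k + 2 \<or> s = k + 3" using assms(1) by linarith
  then show ?thesis using assms(2)
    by (auto simp: null_parallel_def curv_form_def wedge2_def wedge3_def numeral_3_eq_3)
qed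

lemma curv_op_null_parallel:
  assumes "s < 3 + k" "null_parallel (vs!s)" shows "curv_op k c h vs = 0"
proof (cases "s < k")
  case True
  then have "(\<Prod>i<k. (vs!i)$2) = 0" using assms(2) by (auto simp: null_parallel_def)
  then show ?thesis by (simp add: curv_op_def)
next
  case False
  then have "s = k \<or> s = Suc k \<or> s = k + 2" using assms(1) by linarith
  then show ?thesis using assms(2)
    by (auto simp: null_parallel_def curv_op_def wedge2_def wedge3_def vec_eq_6)
qed

lemma prod_Cons:
  "(\<Prod>i<Suc k. ((v # ws) ! i)$2) = v$2 * (\<Prod>i<k. (ws!i)$2)"
  by (simp add: prod.lessThan_Suc_shift del: prod.lessThan_Suc)

text \<open>Differentiating the coefficient \<open>f\<^sup>(\<^sup>k\<^sup>+\<^sup>2\<^sup>)(y)\<close> in direction \<open>v\<close> produces the next coefficient and one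
  more factor \<open>dy(v)\<close>; the connection terms insert a vector of \<open>K\<close> into \<open>\<nabla>\<^sup>kR\<close> and vanish.\<close>

lemma nabla_R_g6:
  assumes "smooth f" "length vs = 4 + k"
  shows "nabla_R (g6 f) k p vs =
     curv_form k ((deriv ^^ (k+2)) f (p$2)) (if k = 0 then 1 else 0) vs"
  using assms(2)
proof (induction k arbitrary: p vs)
  case 0
  have "wedge2 (take 3 vs) 0 = wedge2 vs 0" "wedge3 (take 3 vs) 0 = wedge3 vs 0"
    by (simp_all add: wedge2_def wedge3_def)
  then show ?case
    by (simp add: nabla_R_def curv_tensor_def curv_op_tensor_g6[OF assms(1)])
      (simp add: g6_def curv_form_def wedge2_def wedge3_def numeral_2_eq_2 numeral_3_eq_3 algebra_simps)
next
  case (Suc k)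
  then obtain v ws where vs: "vs = v # ws" and ws: "length ws = 4 + k"
    by (cases vs) auto
  let ?c = "\<lambda>n q. (deriv ^^ n) f (q$2)"
  have "((\<lambda>q. nabla_R (g6 f) k q ws) has_derivative
      (\<lambda>v. curv_form k (?c (Suc (k+2)) p * v$2) 0 ws)) (at p)"
    unfolding Suc.IH[OF ws] curv_form_def
    by (rule derivative_eq_intros iterated_deriv_coordinate_has_derivative[OF assms(1)] refl)+
      (simp add: fun_eq_iff)
  moreover have "nabla_R (g6 f) k p (ws[s := nabla (g6 f) (\<lambda>_. v) (\<lambda>_. ws ! s) p]) = 0"
    if "s < length ws" for s
    using that ws by (subst Suc.IH)
      (auto intro!: curv_form_null_parallel[where s=s]
         simp: null_parallel_def nabla_const christoffel_g6[OF assms(1)])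
  ultimately have "nabla_R (g6 f) (Suc k) p vs = curv_form k (?c (Suc (k+2)) p * v$2) 0 ws"
    unfolding vs by (simp add: nabla_R_def frechet_derivative_eqI)
  also have "\<dots> = curv_form (Suc k) (?c (Suc k + 2) p) 0 vs"
    unfolding vs curv_form_def wedge2_def wedge3_def by (simp add: prod_Cons del: prod.lessThan_Suc)
  finally show ?case by simp
qed

text \<open>For the operator there is one more connection term, which acts on the value. It vanishes because
  the value lies in \<open>K\<close>.\<close>

lemma nabla_R_op_g6:
  assumes "smooth f" "length vs = 3 + k"
  shows "nabla_R_op (g6 f) k p vs =
     curv_op k ((deriv ^^ (k+2)) f (p$2)) (if k = 0 then 1 else 0) vs"
  using assms(2)
proof (induction k arbitrary: p vs)
  case 0
  then show ?case
    by (simp add: nabla_R_op_def curv_op_tensor_g6[OF assms(1)] curv_op_def numeral_2_eq_2)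
next
  case (Suc k)
  then obtain v ws where vs: "vs = v # ws" and ws: "length ws = 3 + k"
    by (cases vs) auto
  let ?c = "\<lambda>n q. (deriv ^^ n) f (q$2)"
  have "((\<lambda>q. nabla_R_op (g6 f) k q ws) has_derivative
      (\<lambda>v. curv_op k (?c (Suc (k+2)) p * v$2) 0 ws)) (at p)"
    unfolding Suc.IH[OF ws] curv_op_def
    by (rule derivative_eq_intros iterated_deriv_coordinate_has_derivative[OF assms(1)] refl)+
      (simp add: fun_eq_iff)
  moreover have "christoffel (g6 f) p v (nabla_R_op (g6 f) k p ws) = 0"
    unfolding Suc.IH[OF ws] by (simp add: christoffel_g6[OF assms(1)] curv_op_def vec_eq_6)
  moreover have "nabla_R_op (g6 f) k p (ws[s := nabla (g6 f) (\<lambda>_. v) (\<lambda>_. ws ! s) p]) = 0"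
    if "s < length ws" for s
    using that ws by (subst Suc.IH)
      (auto intro!: curv_op_null_parallel[where s=s]
         simp: null_parallel_def nabla_const christoffel_g6[OF assms(1)])
  ultimately have "nabla_R_op (g6 f) (Suc k) p vs = curv_op k (?c (Suc (k+2)) p * v$2) 0 ws"
    unfolding vs by (simp add: nabla_R_op_def nabla_def frechet_derivative_eqI)
  also have "\<dots> = curv_op (Suc k) (?c (Suc k + 2) p) 0 vs"
    unfolding vs curv_op_def wedge2_def wedge3_def
    by (simp add: prod_Cons vec_eq_6 del: prod.lessThan_Suc)
  finally show ?case by simp
qed

section \<open>Curvature homogeneity\<close>

text \<open>The linear map that takes the coordinate basis to the frame \<open>a (e\<^sub>1 + F e\<^sub>4)\<close>, \<open>b (e\<^sub>2 + t e\<^sub>3)\<close>, \<open>c e\<^sub>3\<close>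
  and the dual null vectors \<open>e\<^sub>4 / a\<close>, \<open>e\<^sub>5 / b\<close>, \<open>(e\<^sub>6 - t e\<^sub>5) / c\<close>.\<close>

definition model_frame :: "real \<Rightarrow> real \<Rightarrow> real \<Rightarrow> real \<Rightarrow> real \<Rightarrow> real^6 \<Rightarrow> real^6" where
  "model_frame F t a b c w =
     vec6 (a * w$1) (b * w$2) (b * t * w$2 + c * w$3)
       (a * F * w$1 + w$4 / a) (w$5 / b - t / c * w$6) (w$6 / c)"

lemma linear_model_frame: "linear (model_frame F t a b c)"
  by (rule linearI) (simp_all add: model_frame_def vec_eq_6 algebra_simps add_divide_distrib)

lemma bij_model_frame:
  assumes "a \<noteq> 0" "b \<noteq> 0" "c \<noteq> 0" shows "bij (model_frame F t a b c)"
proof -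
  have "inj (model_frame F t a b c)"
    by (rule injI) (use assms in \<open>auto simp: model_frame_def vec_eq_6\<close>)
  then show ?thesis
    using linear_injective_imp_surjective[OF linear_model_frame] unfolding bij_def by blast
qed

lemma g6_model_frame:
  assumes "a \<noteq> 0" "b \<noteq> 0" "c \<noteq> 0" and F: "F = f (P$2) + P$2 * P$3"
  shows "g6 f P (model_frame F t a b c u) (model_frame F t a b c v) = g6 (\<lambda>_. 0) 0 u v"
  using assms(1-3) unfolding F by (simp add: g6_def model_frame_def field_simps)

text \<open>The shear \<open>t\<close> changes the Hessian entry \<open>x\<close> by \<open>2ht\<close>, so at order zero it can be made to vanish; the
  scalings multiply the two coefficients.\<close>

lemma curv_form_model_frame:
  assumes "length vs = 4 + k"
  shows "curv_form k x h (map (model_frame F t a b c) vs) =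
     curv_form k (b ^ k * (a\<^sup>2 * b\<^sup>2) * (x + 2 * h * t)) (b ^ k * (a\<^sup>2 * b * c) * h) vs"
proof -
  have w2: "wedge2 (map (model_frame F t a b c) vs) j = a * b * wedge2 vs j" if "Suc j < length vs" for j
    using that by (simp add: wedge2_def model_frame_def algebra_simps)
  have w3: "wedge3 (map (model_frame F t a b c) vs) j = a * (b * t * wedge2 vs j + c * wedge3 vs j)"
    if "Suc j < length vs" for j
    using that by (simp add: wedge2_def wedge3_def model_frame_def algebra_simps)
  have "(\<Prod>i<k. (map (model_frame F t a b c) vs ! i)$2) = (\<Prod>i<k. b * (vs!i)$2)"
    using assms by (intro prod.cong) (simp_all add: model_frame_def)
  also have "\<dots> = b ^ k * (\<Prod>i<k. (vs!i)$2)"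
    by (simp add: prod.distrib)
  finally have pr: "(\<Prod>i<k. (map (model_frame F t a b c) vs ! i)$2) = b ^ k * (\<Prod>i<k. (vs!i)$2)" .
  show ?thesis
    using assms unfolding curv_form_def pr by (simp add: w2 w3 algebra_simps power2_eq_square)
qed

text \<open>Two tangent spaces that are both isomorphic to one model are isomorphic to each other. Homogeneity
  and being modeled on another space are both obtained in this way.\<close>

lemma isomorphism_via_common_model:
  fixes \<psi> :: "real^'k \<Rightarrow> real^'n" and \<psi>' :: "real^'k \<Rightarrow> real^'m"
    and A :: "nat \<Rightarrow> (real^'n) list \<Rightarrow> real" and A' :: "nat \<Rightarrow> (real^'m) list \<Rightarrow> real"
  assumes \<psi>: "linear \<psi>" "bij \<psi>" and \<psi>': "linear \<psi>'" "bij \<psi>'"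
    and B: "\<And>u v. B (\<psi> u) (\<psi> v) = Bm u v" "\<And>u v. B' (\<psi>' u) (\<psi>' v) = Bm u v"
    and A: "\<And>i vs. i \<le> k \<Longrightarrow> length vs = 4 + i \<Longrightarrow> A i (map \<psi> vs) = Am i vs"
    and A': "\<And>i vs. i \<le> k \<Longrightarrow> length vs = 4 + i \<Longrightarrow> A' i (map \<psi>' vs) = Am i vs"
  shows "\<exists>\<phi>. linear \<phi> \<and> bij \<phi> \<and> (\<forall>u v. B' (\<phi> u) (\<phi> v) = B u v)
     \<and> (\<forall>i\<le>k. \<forall>vs. length vs = 4 + i \<longrightarrow> A' i (map \<phi> vs) = A i vs)"
proof (intro exI[of _ "\<psi>' \<circ> inv \<psi>"] conjI allI impI)
  have inv: "\<psi> (inv \<psi> v) = v" for v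
    using \<psi>(2) by (simp add: bij_is_surj surj_f_inv_f)
  obtain \<kappa> where \<kappa>: "linear \<kappa>" "\<kappa> \<circ> \<psi> = id"
    using linear_injective_left_inverse[OF \<psi>(1)] \<psi>(2) unfolding bij_def by blast
  have "\<kappa> v = inv \<psi> v" for v
    using fun_cong[OF \<kappa>(2), of "inv \<psi> v"] by (simp add: inv)
  then have "inv \<psi> = \<kappa>" by (simp add: fun_eq_iff)
  then show "linear (\<psi>' \<circ> inv \<psi>)" using linear_compose[OF \<kappa>(1) \<psi>'(1)] by simp
  show "bij (\<psi>' \<circ> inv \<psi>)" by (intro bij_comp bij_imp_bij_inv \<psi> \<psi>')
  show "B' ((\<psi>' \<circ> inv \<psi>) u) ((\<psi>' \<circ> inv \<psi>) v) = B u v" for u v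
    using B(1)[of "inv \<psi> u" "inv \<psi> v"] by (simp add: B(2) inv)
  show "A' i (map (\<psi>' \<circ> inv \<psi>) vs) = A i vs" if "i \<le> k" "length vs = 4 + i" for i vs
    using A[OF that(1), of "map (inv \<psi>) vs"] A'[OF that(1), of "map (inv \<psi>) vs"] that(2)
    by (simp add: inv comp_def)
qed

text \<open>The conditions on the frame are \<open>t = -f''/2\<close>, \<open>a\<^sup>2bc = 1\<close>, \<open>a\<^sup>2b\<^sup>3f\<^sup>(\<^sup>3\<^sup>) = 1\<close> and \<open>a\<^sup>2b\<^sup>4f\<^sup>(\<^sup>4\<^sup>) = 1\<close>. The last two give
  \<open>b = f\<^sup>(\<^sup>3\<^sup>)/f\<^sup>(\<^sup>4\<^sup>)\<close>, and positivity of both derivatives makes the resulting value of \<open>a\<^sup>2\<close> positive.\<close>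

lemma normal_frame_g6:
  assumes "smooth f" and pos: "\<And>y. (deriv ^^ 3) f y > 0" "\<And>y. (deriv ^^ 4) f y > 0"
  obtains \<psi> where "linear \<psi>" "bij \<psi>" "\<And>u v. g6 f P (\<psi> u) (\<psi> v) = g6 (\<lambda>_. 0) 0 u v"
    "\<And>i vs. i \<le> 2 \<Longrightarrow> length vs = 4 + i \<Longrightarrow>
       nabla_R (g6 f) i P (map \<psi> vs) = curv_form i (if i = 0 then 0 else 1) (if i = 0 then 1 else 0) vs"
proof -
  let ?c = "\<lambda>n. (deriv ^^ n) f (P$2)"
  define b where "b = ?c 3 / ?c 4"
  define a where "a = sqrt (1 / (b ^ 3 * ?c 3))"
  define c where "c = 1 / (a\<^sup>2 * b)"
  define t where "t = - ?c 2 / 2"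
  have b: "b > 0" using pos by (simp add: b_def)
  have a: "a > 0" using b pos by (simp add: a_def)
  have c: "c > 0" using a b by (simp add: c_def)
  have abc: "a\<^sup>2 * b * c = 1" using a b by (simp add: c_def)
  have a2: "a\<^sup>2 = 1 / (b ^ 3 * ?c 3)"
    unfolding a_def using b pos[of "P$2"] by (intro real_sqrt_pow2) simp
  have ab3: "b * (a\<^sup>2 * b\<^sup>2) * ?c 3 = 1"
    unfolding a2 using b pos[of "P$2"] by (simp add: field_simps power2_eq_square power3_eq_cube)
  have "b * ?c 4 = ?c 3" using pos[of "P$2"] by (simp add: b_def less_imp_neq[symmetric])
  then have ab4: "b\<^sup>2 * (a\<^sup>2 * b\<^sup>2) * ?c 4 = 1"
    using ab3 by (metis (no_types, lifting) mult.assoc mult.commute power2_eq_square)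
  let ?\<psi> = "model_frame (f (P$2) + P$2 * P$3) t a b c"
  have "nabla_R (g6 f) i P (map ?\<psi> vs)
      = curv_form i (if i = 0 then 0 else 1) (if i = 0 then 1 else 0) vs"
    if "i \<le> 2" "length vs = 4 + i" for i vs
  proof -
    have "i = 0 \<or> i = 1 \<or> i = 2" using that(1) by linarith
    then show ?thesis
      using that(2) ab3 ab4 abc
      by (auto simp: nabla_R_g6[OF assms(1)] curv_form_model_frame t_def eval_nat_numeral)
  qed
  with that show ?thesis
    using linear_model_frame bij_model_frame g6_model_frame a b c by (metis less_numeral_extra(3))
qed

lemma curvature_homogeneous_2_g6:
  assumes "smooth f" "\<And>y. (deriv ^^ 3) f y > 0" "\<And>y. (deriv ^^ 4) f y > 0"
  shows "curvature_homogeneous 2 (g6 f)"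
  unfolding curvature_homogeneous_def
proof (intro allI)
  fix P Q
  let ?B = "g6 (\<lambda>_. 0) 0"
  let ?A = "\<lambda>i. curv_form i (if i = 0 then 0 else 1) (if i = 0 then 1 else 0)"
  obtain \<psi> where \<psi>: "linear \<psi>" "bij \<psi>" "\<And>u v. g6 f P (\<psi> u) (\<psi> v) = ?B u v"
    "\<And>i vs. i \<le> 2 \<Longrightarrow> length vs = 4 + i \<Longrightarrow> nabla_R (g6 f) i P (map \<psi> vs) = ?A i vs"
    using normal_frame_g6[OF assms] by blast
  obtain \<psi>' where \<psi>': "linear \<psi>'" "bij \<psi>'" "\<And>u v. g6 f Q (\<psi>' u) (\<psi>' v) = ?B u v"
    "\<And>i vs. i \<le> 2 \<Longrightarrow> length vs = 4 + i \<Longrightarrow> nabla_R (g6 f) i Q (map \<psi>' vs) = ?A i vs"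
    using normal_frame_g6[OF assms] by blast
  show "\<exists>\<phi>. linear \<phi> \<and> bij \<phi> \<and> (\<forall>u v. g6 f Q (\<phi> u) (\<phi> v) = g6 f P u v)
     \<and> (\<forall>i\<le>2. \<forall>vs. length vs = 4 + i \<longrightarrow> nabla_R (g6 f) i Q (map \<phi> vs) = nabla_R (g6 f) i P vs)"
    by (rule isomorphism_via_common_model[where Bm = ?B and Am = ?A and
        B = "g6 f P" and B' = "g6 f Q" and A = "\<lambda>i. nabla_R (g6 f) i P"
        and A' = "\<lambda>i. nabla_R (g6 f) i Q", OF \<psi>(1,2) \<psi>'(1,2) \<psi>(3) \<psi>'(3) \<psi>(4) \<psi>'(4)])
qed

section \<open>The symmetric model\<close>

lemma curv_tensor_g6:
  assumes "smooth f" "length vs = 4"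
  shows "curv_tensor (g6 f) p vs = curv_form 0 ((deriv ^^ 2) f (p$2)) 1 vs"
  using nabla_R_g6[OF assms(1), of vs 0 p] assms(2) by (simp add: nabla_R_def numeral_2_eq_2)

text \<open>At order zero the shear alone removes \<open>f\<close> from the curvature, so any two of these metrics have
  the same model.\<close>

lemma modeled_on_g6:
  assumes "smooth f" "smooth h"
  shows "modeled_on (g6 f) (g6 h)"
  unfolding modeled_on_def
proof (intro allI)
  fix P Q
  let ?\<psi> = "\<lambda>f P. model_frame (f (P$2) + P$2 * P$3) (- (deriv ^^ 2) f (P$2) / 2) 1 1 1"
  have "curv_tensor (g6 f) P (map (?\<psi> f P) vs) = curv_form 0 0 1 vs"
    if "smooth f" "length vs = 4" for f P vs
    using that by (simp add: curv_tensor_g6 curv_form_model_frame)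
  then show "\<exists>\<phi>. linear \<phi> \<and> bij \<phi> \<and> (\<forall>u v. g6 h Q (\<phi> u) (\<phi> v) = g6 f P u v)
     \<and> (\<forall>vs. length vs = 4 \<longrightarrow> curv_tensor (g6 h) Q (map \<phi> vs) = curv_tensor (g6 f) P vs)"
    using isomorphism_via_common_model[of "?\<psi> f P" "?\<psi> h Q" "g6 f P" "g6 (\<lambda>_. 0) 0" "g6 h Q" 0
        "\<lambda>_. curv_tensor (g6 f) P" "\<lambda>_. curv_form 0 0 1" "\<lambda>_. curv_tensor (g6 h) Q"] assms
    by (simp add: linear_model_frame bij_model_frame g6_model_frame)
qed

text \<open>The reflection of the coordinates in \<open>P\<close> changes \<open>-2yz\<^sub>0 dx\<^sup>2\<close> by \<open>-2q dx\<^sup>2\<close> with \<open>q\<close> affine in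
  \<open>y, z\<^sub>0\<close>. With \<open>s = x - x(P)\<close>, the corrections \<open>A = -sq\<close>, \<open>B = -z\<^sub>0(P)s\<^sup>2\<close>, \<open>C = -y(P)s\<^sup>2\<close> of the barred
  coordinates solve \<open>dx dA + dy dB + dz\<^sub>0 dC + q dx\<^sup>2 = 0\<close>, so the corrected map is an isometry. Its
  differential at \<open>P\<close> is still \<open>-1\<close>, because \<open>s\<close> and \<open>q\<close> vanish there.\<close>

definition central_symmetry :: "real^6 \<Rightarrow> real^6 \<Rightarrow> real^6" where
  "central_symmetry P p = vec6 (2 * P$1 - p$1) (2 * P$2 - p$2) (2 * P$3 - p$3)
     (2 * P$4 - p$4 - (p$1 - P$1) * (4 * P$2 * P$3 - 2 * P$2 * p$3 - 2 * P$3 * p$2))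
     (2 * P$5 - p$5 - P$3 * ((p$1 - P$1) * (p$1 - P$1)))
     (2 * P$6 - p$6 - P$2 * ((p$1 - P$1) * (p$1 - P$1)))"

lemma central_symmetry_has_derivative:
  "(central_symmetry P has_derivative (\<lambda>v. vec6 (- v$1) (- v$2) (- v$3)
     (- v$4 - v$1 * (4 * P$2 * P$3 - 2 * P$2 * p$3 - 2 * P$3 * p$2)
        + (p$1 - P$1) * (2 * P$2 * v$3 + 2 * P$3 * v$2))
     (- v$5 - 2 * P$3 * (p$1 - P$1) * v$1) (- v$6 - 2 * P$2 * (p$1 - P$1) * v$1))) (at p)"
  unfolding central_symmetry_def[abs_def]
  by (rule vec6_has_derivative;
     (rule derivative_eq_intros bounded_linear_imp_has_derivative bounded_linear_vec_nth refl)+)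
    (auto simp: algebra_simps fun_eq_iff)

lemma smooth_central_symmetry: "smooth (central_symmetry P)"
proof -
  have "\<forall>i. real_polynomial_function (\<lambda>p. central_symmetry P p $ i)"
    unfolding forall_6 central_symmetry_def vec6_nth
    by (rule conjI real_polynomial_function_diff real_polynomial_function.intros(3,4)
        | rule real_polynomial_function_vec_nth | rule real_polynomial_function.intros(2))+
  then have "polynomial_function (central_symmetry P)"
    by (auto simp: polynomial_function_iff_Basis_inner Basis_vec_def inner_axis)
  then show ?thesis by (rule polynomial_function_smooth)
qed

lemma smooth_zero: "smooth (\<lambda>_::real. 0::real)"
  by (intro polynomial_function_smooth) (simp add: polynomial_function_const)

lemma symmetric_space_g6_0: "symmetric_space (g6 (\<lambda>_. 0))"
  unfolding symmetric_space_def
proof (intro conjI allI)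
  show "pseudo_riemannian (g6 (\<lambda>_. 0))" by (rule pseudo_riemannian_g6[OF smooth_zero])
next
  fix P :: "real^6"
  let ?\<sigma> = "central_symmetry P"
  have "?\<sigma> (?\<sigma> p) = p" for p
    unfolding vec_eq_6 by (simp add: central_symmetry_def algebra_simps)
  then have inv: "?\<sigma> \<circ> ?\<sigma> = id" by (simp add: fun_eq_iff)
  then have "bij ?\<sigma>" "inv ?\<sigma> = ?\<sigma>" using o_bij inv_unique_comp by blast+
  moreover have "g6 (\<lambda>_. 0) (?\<sigma> p) (frechet_derivative ?\<sigma> (at p) u) (frechet_derivative ?\<sigma> (at p) v)
      = g6 (\<lambda>_. 0) p u v" for p u v
    unfolding frechet_derivative_eqI[OF central_symmetry_has_derivative]
    by (simp add: g6_def central_symmetry_def algebra_simps)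
  ultimately have "isometry (g6 (\<lambda>_. 0)) ?\<sigma>"
    unfolding isometry_def by (simp add: smooth_central_symmetry)
  moreover have "?\<sigma> P = P" by (simp add: central_symmetry_def vec_eq_6)
  moreover have "frechet_derivative ?\<sigma> (at P) v = - v" for v
    unfolding frechet_derivative_eqI[OF central_symmetry_has_derivative]
    by (simp add: vec_eq_6)
  ultimately show "\<exists>\<sigma>. isometry (g6 (\<lambda>_. 0)) \<sigma> \<and> \<sigma> P = P \<and>
      (\<forall>v. frechet_derivative \<sigma> (at P) v = - v)" by blast
qed

text \<open>If \<open>V1\<close> contains a vector \<open>a\<close> with \<open>dx(a) \<noteq> 0\<close>, then every \<open>b\<close> in \<open>V2\<close> has unbarred part
  proportional to that of \<open>a\<close>. If \<open>dx(b) \<noteq> 0\<close> for some \<open>b\<close>, then by the same argument all of \<open>V1\<close>, and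
  hence the whole space, would have unbarred parts on one line. So \<open>V2\<close> lies in \<open>K\<close>, is therefore
  orthogonal to itself as well as to \<open>V1\<close>, and is trivial since the metric is nondegenerate.\<close>

lemma orthogonal_summand_trivial:
  assumes sum: "\<And>v. \<exists>a\<in>V1. \<exists>b\<in>V2. v = a + b"
    and orth: "\<And>a b. a \<in> V1 \<Longrightarrow> b \<in> V2 \<Longrightarrow> g6 f Q a b = 0"
    and parallel: "\<And>a b. a \<in> V1 \<Longrightarrow> b \<in> V2 \<Longrightarrow> a$1 * b$2 = a$2 * b$1 \<and> a$1 * b$3 = a$3 * b$1"
    and a: "a \<in> V1" "a$1 \<noteq> 0"
  shows "V2 \<subseteq> {0}"
proof
  have b1: "b$1 = 0" if b: "b \<in> V2" for b
  proof (rule ccontr)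
    assume nz: "b$1 \<noteq> 0"
    obtain a' b' where *: "a' \<in> V1" "b' \<in> V2" "axis 2 1 = a' + b'" using sum by blast
    have "a'$1 + b'$1 = 0" "a'$2 + b'$2 = 1"
      using arg_cong[OF *(3), of "\<lambda>v. v$1"] arg_cong[OF *(3), of "\<lambda>v. v$2"] by simp_all
    moreover have "a'$1 * b$2 = a'$2 * b$1" "a$1 * b'$2 = a$2 * b'$1" "a$1 * b$2 = a$2 * b$1"
      using parallel * a b by blast+
    ultimately have "a$1 * b$1 = 0" by algebra
    then show False using a nz by simp
  qed
  fix b assume b: "b \<in> V2"
  have "b$1 = 0" "b$2 = 0" "b$3 = 0" using b1[OF b] parallel[OF a(1) b] a(2) by auto
  have "g6 f Q b v = 0" for v
  proof -
    obtain a' b' where *: "a' \<in> V1" "b' \<in> V2" "v = a' + b'" using sum by blast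
    have "b'$1 = 0" "b'$2 = 0" "b'$3 = 0" using b1[OF *(2)] parallel[OF a(1) *(2)] a(2) by auto
    with \<open>b$1 = 0\<close> \<open>b$2 = 0\<close> \<open>b$3 = 0\<close> have "g6 f Q b v = g6 f Q a' b"
      unfolding *(3) by (simp add: g6_def algebra_simps)
    then show ?thesis using orth[OF *(1) b] by simp
  qed
  from this[of "axis 1 1"] this[of "axis 2 1"] this[of "axis 3 1"]
  show "b \<in> {0}"
    using \<open>b$1 = 0\<close> \<open>b$2 = 0\<close> \<open>b$3 = 0\<close> by (simp add: vec_eq_6 g6_def)
qed

text \<open>For \<open>a\<close> in \<open>V1\<close> and \<open>b\<close> in \<open>V2\<close> the components \<open>R(a, b, c, d)\<close> are mixed for all \<open>c, d\<close> in either
  summand, hence vanish for all \<open>c, d\<close>. The Hessian being nondegenerate, the bivector \<open>a \<and> b\<close> has no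
  \<open>(1,2)\<close> and no \<open>(1,3)\<close> component.\<close>

lemma irreducible_space_g6:
  assumes "smooth f" shows "irreducible_space (g6 f)"
  unfolding irreducible_space_def irreducible_model_def
proof (intro allI notI; elim exE conjE)
  fix Q V1 V2
  assume sub: "subspace V1" "subspace V2" "V1 \<noteq> {0}" "V2 \<noteq> {0}"
    and sum: "{a + b |a b. a \<in> V1 \<and> b \<in> V2} = UNIV"
    and orth: "\<forall>a\<in>V1. \<forall>b\<in>V2. g6 f Q a b = 0 \<and> g6 f Q b a = 0"
    and mixed: "\<forall>vs. length vs = 4 \<and> set vs \<subseteq> V1 \<union> V2 \<and> \<not> set vs \<subseteq> V1 \<and> \<not> set vs \<subseteq> V2 \<longrightarrow>
      curv_tensor (g6 f) Q vs = 0"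
    and inter: "V1 \<inter> V2 = {0}"
  let ?h = "(deriv ^^ 2) f (Q$2)"
  have dec: "\<exists>a\<in>V1. \<exists>b\<in>V2. v = a + b" for v using sum by blast
  have par: "a$1 * b$2 = a$2 * b$1 \<and> a$1 * b$3 = a$3 * b$1" if ab: "a \<in> V1" "b \<in> V2" for a b
  proof (cases "a = 0 \<or> b = 0")
    case True then show ?thesis by auto
  next
    case False
    then have nin: "a \<notin> V2" "b \<notin> V1" using ab inter by blast+
    have 0: "curv_form 0 ?h 1 [a, b, c, d] = 0" if "c \<in> V1 \<union> V2" "d \<in> V1 \<union> V2" for c d
      using mixed[rule_format, of "[a,b,c,d]"] ab nin that curv_tensor_g6[OF assms, of "[a,b,c,d]" Q] by auto
    \<comment> \<open>By bilinearity in the last two arguments, which decompose along \<open>V1\<close> and \<open>V2\<close>.\<close>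
    have R0: "curv_form 0 ?h 1 [a, b, c, d] = 0" for c d
    proof -
      obtain c1 c2 d1 d2 where cd: "c = c1 + c2" "d = d1 + d2" and
        "c1 \<in> V1" "c2 \<in> V2" "d1 \<in> V1" "d2 \<in> V2" using dec by metis
      moreover have "curv_form 0 ?h 1 [a, b, c, d] =
          curv_form 0 ?h 1 [a, b, c1, d1] + curv_form 0 ?h 1 [a, b, c1, d2]
          + curv_form 0 ?h 1 [a, b, c2, d1] + curv_form 0 ?h 1 [a, b, c2, d2]"
        unfolding cd curv_form_def wedge2_def wedge3_def by (simp add: algebra_simps)
      ultimately show ?thesis by (simp add: 0)
    qed
    show ?thesis
      using R0[of "axis 1 1" "axis 2 1"] R0[of "axis 1 1" "axis 3 1"]
      by (simp add: curv_form_def wedge2_def wedge3_def)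
  qed
  obtain a b where ab: "a \<in> V1" "b \<in> V2" "axis 1 1 = a + b" using dec by blast
  from arg_cong[OF ab(3), of "\<lambda>v. v$1"] have "a$1 \<noteq> 0 \<or> b$1 \<noteq> 0" by auto
  then show False
  proof
    assume "a$1 \<noteq> 0"
    with orthogonal_summand_trivial[OF dec _ par ab(1)] orth have "V2 \<subseteq> {0}" by blast
    then show False using sub subspace_0 by blast
  next
    assume "b$1 \<noteq> 0"
    have "\<exists>b\<in>V2. \<exists>a\<in>V1. v = b + a" for v using dec[of v] by (metis add.commute)
    from orthogonal_summand_trivial[OF this _ _ ab(2) \<open>b$1 \<noteq> 0\<close>] orth par
    have "V1 \<subseteq> {0}" by (metis mult.commute)
    then show False using sub subspace_0 by blast
  qed
qed

section \<open>Geodesic completeness\<close>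

lemma eq_on_interval_if_same_vector_derivative:
  fixes F G :: "real \<Rightarrow> 'a::euclidean_space"
  assumes "open I" "is_interval I" "t0 \<in> I" "t \<in> I" "F t0 = G t0"
    and "\<And>t. t \<in> I \<Longrightarrow> (F has_vector_derivative D t) (at t)"
    and "\<And>t. t \<in> I \<Longrightarrow> (G has_vector_derivative D t) (at t)"
  shows "F t = G t"
proof -
  have "((\<lambda>t. F t - G t) has_derivative (\<lambda>h. 0)) (at t)" if "t \<in> I" for t
    using has_vector_derivative_diff[OF assms(6,7)[OF that]]
    by (simp add: has_vector_derivative_def)
  then have "F t - G t = F t0 - G t0"
    by (rule has_derivative_zero_unique_connected[OF assms(1) is_interval_connected[OF assms(2)] _ assms(4,3)])
  then show ?thesis using assms(5) by simp
qed

lemma antiderivative_with_initial_value: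
  fixes K :: "real \<Rightarrow> 'a::euclidean_space"
  assumes "continuous_on UNIV K"
  obtains G where "\<And>t. (G has_vector_derivative K t) (at t)" "G t0 = x0"
proof -
  have "\<exists>F. \<forall>t. -\<infinity> < ereal t \<longrightarrow> ereal t < \<infinity> \<longrightarrow> (F has_vector_derivative K t) (at t)"
    using assms by (intro einterval_antiderivative) (simp_all add: continuous_on_eq_continuous_at)
  then obtain F where "\<And>t. (F has_vector_derivative K t) (at t)" by auto
  then have "((\<lambda>t. F t - F t0 + x0) has_vector_derivative K t) (at t)" for t
    by (auto intro!: derivative_eq_intros)
  from that[OF this] show thesis by simp
qed

lemma vec_nth_has_vector_derivative:
  "(F has_vector_derivative D) (at t) \<Longrightarrow> ((\<lambda>t. F t $ i) has_vector_derivative D $ i) (at t)"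
  by (rule bounded_linear.has_vector_derivative[OF bounded_linear_vec_nth])

text \<open>Starting from the position and velocity of a given geodesic at one time \<open>t0\<close>, the line \<open>l\<close> in
  coordinates predicts \<open>x, y, z\<^sub>0\<close> for all times. As the Christoffel map sees nothing else, the acceleration
  is a known continuous function of time, and two integrations give the extension.\<close>

lemma geodesically_complete_g6:
  assumes "smooth f" shows "geodesically_complete (g6 f)"
  unfolding geodesically_complete_def
proof (intro allI impI; elim conjE)
  fix I :: "real set" and \<gamma>
  assume I: "open I" "is_interval I" and geo: "geodesic_on (g6 f) I \<gamma>"
  let ?C = "christoffel (g6 f)"
  have C_upper: "?C p u u $ i = 0" if "i \<in> {1,2,3}" for p u i
    using that by (auto simp: christoffel_g6[OF assms])
  have C_cong: "?C p u u = ?C q v v" if "\<And>i. i \<in> {1,2,3} \<Longrightarrow> p$i = q$i \<and> u$i = v$i" for p q u v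
    using that by (simp add: christoffel_g6[OF assms])
  show "\<exists>\<delta>. geodesic_on (g6 f) UNIV \<delta> \<and> (\<forall>t\<in>I. \<delta> t = \<gamma> t)"
  proof (cases "I = {}")
    case True
    have "geodesic_on (g6 f) UNIV (\<lambda>_. 0)"
      unfolding geodesic_on_def by (intro exI[of _ "\<lambda>_. 0"]) (simp add: christoffel_zero_left[OF assms])
    then show ?thesis using True by blast
  next
    case False
    then obtain t0 where t0: "t0 \<in> I" by blast
    obtain \<gamma>' where \<gamma>: "\<And>t. t \<in> I \<Longrightarrow> (\<gamma> has_vector_derivative \<gamma>' t) (at t)"
      and \<gamma>': "\<And>t. t \<in> I \<Longrightarrow> (\<gamma>' has_vector_derivative - ?C (\<gamma> t) (\<gamma>' t) (\<gamma>' t)) (at t)"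
      using geo unfolding geodesic_on_def by blast
    define l where "l t = \<gamma> t0 + (t - t0) *\<^sub>R \<gamma>' t0" for t
    define acc where "acc t = - ?C (l t) (\<gamma>' t0) (\<gamma>' t0)" for t
    have "continuous_on UNIV (\<lambda>t. ?C (l t) (\<gamma>' t0) (\<gamma>' t0))"
    proof (rule continuous_on_compose2[where g = "\<lambda>p. ?C p (\<gamma>' t0) (\<gamma>' t0)" and t = UNIV])
      show "continuous_on UNIV (\<lambda>p. ?C p (\<gamma>' t0) (\<gamma>' t0))"
        by (rule has_derivative_continuous_on[OF christoffel_g6_has_derivative[OF assms]])
      show "continuous_on UNIV l" unfolding l_def by (intro continuous_intros)
    qed simp
    then have "continuous_on UNIV acc" unfolding acc_def by (rule continuous_on_minus)
    then obtain \<delta>' where \<delta>': "\<And>t. (\<delta>' has_vector_derivative acc t) (at t)" "\<delta>' t0 = \<gamma>' t0"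
      using antiderivative_with_initial_value by blast
    then have "continuous_on UNIV \<delta>'"
      by (auto intro!: continuous_at_imp_continuous_on has_vector_derivative_continuous)
    then obtain \<delta> where \<delta>: "\<And>t. (\<delta> has_vector_derivative \<delta>' t) (at t)" "\<delta> t0 = \<gamma> t0"
      using antiderivative_with_initial_value by blast
    \<comment> \<open>Stated for a curve on any interval, as it serves for both the given geodesic and its extension.\<close>
    have affine: "c t $ i = l t $ i \<and> c' t $ i = \<gamma>' t0 $ i"
      if J: "open J" "is_interval J" "t0 \<in> J" "t \<in> J" and i: "i \<in> {1,2,3}"
        and c: "\<And>t. t \<in> J \<Longrightarrow> (c has_vector_derivative c' t) (at t)" "c t0 = \<gamma> t0"
        and c': "\<And>t. t \<in> J \<Longrightarrow> (c' has_vector_derivative - ?C (p t) (u t) (u t)) (at t)" "c' t0 = \<gamma>' t0"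
      for J t i c c' p u
    proof -
      have *: "c' t $ i = \<gamma>' t0 $ i" if "t \<in> J" for t
      proof (rule eq_on_interval_if_same_vector_derivative[OF J(1-3) that, where D = "\<lambda>_. 0"])
        show "((\<lambda>t. c' t $ i) has_vector_derivative 0) (at t)" if "t \<in> J" for t
          using vec_nth_has_vector_derivative[OF c'(1)[OF that], of i] C_upper[OF i] by simp
      qed (use c'(2) in auto)
      have "c t $ i = l t $ i"
      proof (rule eq_on_interval_if_same_vector_derivative[OF J, where D = "\<lambda>_. \<gamma>' t0 $ i"])
        show "((\<lambda>t. c t $ i) has_vector_derivative \<gamma>' t0 $ i) (at t)" if "t \<in> J" for t
          using vec_nth_has_vector_derivative[OF c(1)[OF that], of i] *[OF that] by simp
        show "((\<lambda>t. l t $ i) has_vector_derivative \<gamma>' t0 $ i) (at t)" for t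
          unfolding l_def by (rule vec_nth_has_vector_derivative) (auto intro!: derivative_eq_intros)
      qed (simp add: l_def c(2))
      then show ?thesis using *[OF J(4)] by blast
    qed
    have "?C (\<delta> t) (\<delta>' t) (\<delta>' t) = ?C (l t) (\<gamma>' t0) (\<gamma>' t0)" for t
      by (rule C_cong, rule affine[of UNIV _ _ \<delta> \<delta>' l "\<lambda>_. \<gamma>' t0"]) (use \<delta> \<delta>' in \<open>simp_all add: acc_def\<close>)
    then have "geodesic_on (g6 f) UNIV \<delta>"
      unfolding geodesic_on_def using \<delta> \<delta>' unfolding acc_def by (intro exI[of _ \<delta>']) simp
    moreover have "?C (\<gamma> t) (\<gamma>' t) (\<gamma>' t) = ?C (l t) (\<gamma>' t0) (\<gamma>' t0)" if "t \<in> I" for t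
      by (rule C_cong, rule affine[OF I t0 that _ \<gamma> refl \<gamma>' refl])
    then have "(\<gamma>' has_vector_derivative acc t) (at t)" if "t \<in> I" for t
      using \<gamma>'[OF that] that unfolding acc_def by simp
    then have "\<delta>' t = \<gamma>' t" if "t \<in> I" for t
      using eq_on_interval_if_same_vector_derivative[OF I t0 that, of \<delta>' \<gamma>' acc] \<delta>' by simp
    then have "(\<gamma> has_vector_derivative \<delta>' t) (at t)" if "t \<in> I" for t
      using \<gamma>[OF that] that by simp
    then have "\<delta> t = \<gamma> t" if "t \<in> I" for t
      using eq_on_interval_if_same_vector_derivative[OF I t0 that, of \<delta> \<gamma> \<delta>'] \<delta> that by simp
    ultimately show ?thesis by blast
  qed
qed

section \<open>Scalar Weyl invariants\<close>

lemma nabla_R_product_null_parallel: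
  assumes "smooth f"
  shows "length vs = product_rank ks \<Longrightarrow> s < length vs \<Longrightarrow> null_parallel (vs!s) \<Longrightarrow>
     nabla_R_product (g6 f) ks p vs = 0"
proof (induction ks arbitrary: vs s)
  case Nil then show ?case by (simp add: product_rank_def)
next
  case (Cons k ks)
  have len: "length vs = 4 + k + product_rank ks"
    using Cons.prems(1) by (simp add: product_rank_def)
  show ?case
  proof (cases "s < 4 + k")
    case True
    have "nabla_R (g6 f) k p (take (4 + k) vs) = 0"
      using len True Cons.prems(3)
      by (subst nabla_R_g6[OF assms]) (auto intro!: curv_form_null_parallel[where s = s])
    then show ?thesis by simp
  next
    case False
    have "nabla_R_product (g6 f) ks p (drop (4 + k) vs) = 0"
      using len False Cons.prems by (intro Cons.IH[of _ "s - (4 + k)"]) auto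
    then show ?thesis by simp
  qed
qed

text \<open>One pair of slots already suffices: either both carry an unbarred index, and the entry of
  the inverse metric vanishes, or one carries a barred index, and the tensor vanishes.\<close>

lemma weyl_invariants_g6_vanish:
  assumes "smooth f" "h \<in> weyl_invariants (g6 f)"
  shows "h P = 0"
  using assms(2)
proof (induction rule: weyl_invariants.induct)
  case (contract ks \<pi>)
  let ?N = "product_rank ks"
  have N: "4 \<le> ?N"
    using contract(1) by (cases ks) (auto simp: product_rank_def)
  then have \<pi>: "\<pi> 0 < ?N" "\<pi> 1 < ?N"
    using contract(3) by (auto simp: bij_betw_def)
  have "(\<Prod>j<?N div 2. inv_metric (g6 f) P $ (is ! \<pi> (2 * j)) $ (is ! \<pi> (2 * j + 1)))
        * nabla_R_product (g6 f) ks P (map (\<lambda>i. axis i 1) is) = 0"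
    if len: "length is = ?N" for "is" :: "6 list"
  proof (cases "is ! \<pi> 0 \<in> {1,2,3} \<and> is ! \<pi> 1 \<in> {1,2,3}")
    case True
    then have "inv_metric (g6 f) P $ (is ! \<pi> (2 * 0)) $ (is ! \<pi> (2 * 0 + 1)) = 0"
      by (auto simp: inv_metric_g6)
    moreover have "0 \<in> {..<?N div 2}" using N by simp
    ultimately have "(\<Prod>j<?N div 2. inv_metric (g6 f) P $ (is ! \<pi> (2 * j)) $ (is ! \<pi> (2 * j + 1))) = 0"
      by (intro prod_zero finite_lessThan bexI[of _ 0])
    then show ?thesis by simp
  next
    case False
    have "null_parallel (axis i 1)" if "i \<notin> {1,2,3}" for i :: 6
      using that exhaust_6[of i] by (auto simp: null_parallel_def)
    then obtain s where "s < ?N" "null_parallel (map (\<lambda>i. axis i 1) is ! s)"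
      using False \<pi> len by (metis nth_map)
    then show ?thesis
      using nabla_R_product_null_parallel[OF assms(1), of "map (\<lambda>i. axis i 1) is" ks s P] len by simp
  qed
  then show ?case unfolding contraction_def by (intro sum.neutral) blast
qed auto

section \<open>An affine invariant of third order\<close>

lemma nabla_R_op_replicate:
  assumes "smooth f" "k > 0"
  shows "nabla_R_op (g6 f) k p (replicate k u @ [v, w, z]) =
     (u$2 ^ k * (deriv ^^ (k+2)) f (p$2)) *\<^sub>R
       (v$1 * w$2 - v$2 * w$1) *\<^sub>R vec6 0 0 0 (z$2) (- z$1) 0"
  using assms(2)
  by (simp add: nabla_R_op_g6[OF assms(1)] curv_op_def wedge2_def nth_append numeral_2_eq_2)

text \<open>Evaluate \<open>\<nabla>\<^sup>k\<R>\<close> at \<open>P\<close> on \<open>k\<close> copies of \<open>e\<^sub>2\<close> followed by \<open>e\<^sub>1, e\<^sub>2, e\<^sub>2\<close>; the value is a multiple of \<open>e\<^sub>4\<close>. An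
  isomorphism \<open>\<phi>\<close> carries it to \<open>f\<^sup>(\<^sup>k\<^sup>+\<^sup>2\<^sup>)\<close> times the fixed vector \<open>X = \<phi> e\<^sub>4\<close>, while the value at \<open>Q\<close> is
  \<open>m\<^sup>k f\<^sup>(\<^sup>k\<^sup>+\<^sup>2\<^sup>)\<close> times another fixed vector \<open>Y\<close>, with \<open>m = dy(\<phi> e\<^sub>2)\<close>. Comparing \<open>k = 1, 2, 3\<close> eliminates
  \<open>X\<close>, \<open>Y\<close> and \<open>m\<close>.\<close>

lemma affine_homogeneous_alpha6_constant:
  assumes "smooth f" and pos: "\<And>y. (deriv ^^ 3) f y > 0" "\<And>y. (deriv ^^ 4) f y > 0"
    and "affine_curvature_homogeneous 3 (g6 f)"
  shows "alpha6 f y = alpha6 f y'"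
proof -
  let ?P = "axis 2 y :: real^6" and ?Q = "axis 2 y' :: real^6"
  let ?p = "\<lambda>n. (deriv ^^ n) f y" and ?q = "\<lambda>n. (deriv ^^ n) f y'"
  obtain \<phi> where \<phi>: "linear \<phi>" "bij \<phi>" and eq: "\<And>i vs. i \<le> 3 \<Longrightarrow> length vs = 3 + i \<Longrightarrow>
      nabla_R_op (g6 f) i ?Q (map \<phi> vs) = \<phi> (nabla_R_op (g6 f) i ?P vs)"
    using assms(4) unfolding affine_curvature_homogeneous_def by blast
  define e where "e i = (axis i 1 :: real^6)" for i
  define X where "X = \<phi> (e 4)"
  define Y where "Y = (\<phi> (e 1) $ 1 * \<phi> (e 2) $ 2 - \<phi> (e 1) $ 2 * \<phi> (e 2) $ 1) *\<^sub>R
     vec6 0 0 0 (\<phi> (e 2) $ 2) (- \<phi> (e 2) $ 1) 0"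
  define m where "m = \<phi> (e 2) $ 2"
  have rel: "(m ^ k * ?q (k+2)) *\<^sub>R Y = ?p (k+2) *\<^sub>R X" if "0 < k" "k \<le> 3" for k
  proof -
    have "nabla_R_op (g6 f) k ?P (replicate k (e 2) @ [e 1, e 2, e 2]) = ?p (k+2) *\<^sub>R e 4"
      unfolding nabla_R_op_replicate[OF assms(1) that(1)] e_def by (simp add: vec_eq_6)
    then show ?thesis
      using eq[OF that(2), of "replicate k (e 2) @ [e 1, e 2, e 2]"]
      by (simp add: nabla_R_op_replicate[OF assms(1) that(1)] X_def Y_def m_def linear_scale[OF \<phi>(1)])
  qed
  have "X \<noteq> 0"
  proof
    assume "X = 0"
    then have "\<phi> (e 4) = \<phi> 0" using linear_0[OF \<phi>(1)] by (simp add: X_def)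
    then have "e 4 = 0" using \<phi>(2) by (simp add: bij_def inj_eq)
    then show False by (simp add: e_def)
  qed
  then obtain i where i: "X $ i \<noteq> 0" by (auto simp: vec_eq_iff)
  let ?x = "X $ i" and ?y = "Y $ i"
  have r: "m * ?q 3 * ?y = ?p 3 * ?x" "m\<^sup>2 * ?q 4 * ?y = ?p 4 * ?x" "m ^ 3 * ?q 5 * ?y = ?p 5 * ?x"
    using rel[of 1] rel[of 2] rel[of 3]
    by (simp_all add: vec_eq_iff eval_nat_numeral)
  then have "m * ?y \<noteq> 0" using i pos(1)[of y] by auto
  \<comment> \<open>Both sides contain \<open>m\<^sup>4\<close>, so \<open>m\<close> cancels in the ratio of \<open>f\<^sup>(\<^sup>3\<^sup>) f\<^sup>(\<^sup>5\<^sup>)\<close> to the square of \<open>f\<^sup>(\<^sup>4\<^sup>)\<close>.\<close>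
  have "(m * ?q 3 * ?y) * (m ^ 3 * ?q 5 * ?y) * (?p 4 * ?x)\<^sup>2
      = (?p 3 * ?x) * (?p 5 * ?x) * (m\<^sup>2 * ?q 4 * ?y)\<^sup>2"
    unfolding r ..
  then have "(m ^ 4 * ?y\<^sup>2 * ?x\<^sup>2) * (?q 3 * ?q 5 * (?p 4 * ?p 4))
      = (m ^ 4 * ?y\<^sup>2 * ?x\<^sup>2) * (?p 3 * ?p 5 * (?q 4 * ?q 4))"
    by (simp only: power2_eq_square power3_eq_cube power4_eq_xxxx mult_ac)
  then have "?q 3 * ?q 5 * (?p 4 * ?p 4) = ?p 3 * ?p 5 * (?q 4 * ?q 4)"
    using \<open>m * ?y \<noteq> 0\<close> i by simp
  then show ?thesis
    using pos(2)[of y] pos(2)[of y'] unfolding alpha6_def by (simp add: frac_eq_eq)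
qed

lemma not_affine_curvature_homogeneous_3_g6:
  assumes "smooth f" "\<And>y. (deriv ^^ 3) f y > 0" "\<And>y. (deriv ^^ 4) f y > 0" "generic f"
  shows "\<not> affine_curvature_homogeneous 3 (g6 f)"
proof
  assume "affine_curvature_homogeneous 3 (g6 f)"
  then have "alpha6 f = (\<lambda>_. alpha6 f 0)"
    using affine_homogeneous_alpha6_constant[OF assms(1-3)] by blast
  then have "deriv (alpha6 f) y = 0" for y
    by (metis deriv_const)
  then have "discrete (UNIV :: real set)"
    using assms(4) by (simp add: generic_def)
  then show False
    unfolding discrete_def isolated_in_def using not_open_singleton[of "0::real"] by simp
qed

theorem theorem1p6:
  fixes f :: "real \<Rightarrow> real"
  assumes "smooth f"
    and "\<And>y. (deriv ^^ 3) f y > 0"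
    and "\<And>y. (deriv ^^ 4) f y > 0"
  shows "pseudo_riemannian (g6 f)
    \<and> (\<forall>P. has_signature (g6 f P) 3 3)
    \<and> curvature_homogeneous 2 (g6 f)
    \<and> geodesically_complete (g6 f)
    \<and> (\<exists>gN :: 6 metric. symmetric_space gN \<and> (\<forall>Q. has_signature (gN Q) 3 3)
          \<and> irreducible_space gN \<and> modeled_on (g6 f) gN)
    \<and> (\<forall>h\<in>weyl_invariants (g6 f). \<forall>P. h P = 0)
    \<and> (generic f \<longrightarrow> \<not> affine_curvature_homogeneous 3 (g6 f))"
proof -
  have "symmetric_space (g6 (\<lambda>_. 0)) \<and> (\<forall>Q. has_signature (g6 (\<lambda>_. 0) Q) 3 3)
      \<and> irreducible_space (g6 (\<lambda>_. 0)) \<and> modeled_on (g6 f) (g6 (\<lambda>_. 0))"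
    using symmetric_space_g6_0 has_signature_g6 irreducible_space_g6[OF smooth_zero]
      modeled_on_g6[OF assms(1) smooth_zero] by blast
  then show ?thesis
    using pseudo_riemannian_g6[OF assms(1)] has_signature_g6 curvature_homogeneous_2_g6[OF assms]
      geodesically_complete_g6[OF assms(1)] weyl_invariants_g6_vanish[OF assms(1)]
      not_affine_curvature_homogeneous_3_g6[OF assms] by blast
qed


end
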